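(* For all $w\in S_n$, $$\overline{Z}^\square_{1_W,w}(\boldsymbol{x};\boldsymbol{y})=(-1)^{\ell(w^{-1}w_0)}\,\mathfrak{G}_w(\boldsymbol{x};\boldsymbol{y}),$$ where $\overline{Z}^\square_{1_W,w}$ is the specialization of $Z^\square_{1_W,w}$ at $t=0$ and $\mathfrak{G}_w$ is the double Grothendieck polynomial.
   Context: $1_W\in S_n$ is the identity, $s_i=(i,i+1)$, $w_0(i)=n+1-i$, $\ell$ the length, $<$ Bruhat order, products are compositions. Double Grothendieck (Laurent) polynomials: let $s_i$ act on functions of $(\boldsymbol{x};\boldsymbol{y})$ by exchanging $x_i,x_{i+1}$ and let $\overline\partial_i f=\dfrac{x_{i+1}f-x_i\,s_if}{x_{i+1}-x_i}$ (these satisfy the braid relations). Then $\mathfrak{G}_w$ is defined by $\mathfrak{G}_{w_0}=\prod_{i+j\le n}(1-x_i/y_j)$ and $\mathfrak{G}_{ws_i}=\overline\partial_i\mathfrak{G}_w$ whenever $ws_i<w$. Lattice model ($\square=(n,n-1,\dots,1)$): an $n\times n$ square grid with rows numbered $1,\dots,n$ from top to bottom and columns numbered $1,\dots,n$ from right to left; $t$ is an indeterminate, and the vertex in row $i$, column $j$ has parameters $x=x_i$, $y=y_j$. Horizontal edges carry a spin in $\{+,1,\dots,n\}$ ($+$ = uncolored), vertical edges carry a subset of the color set $\{1<\dots<n\}$. The weight of a vertex with left spin $L$, top spin $\Sigma$, right spin $L'$, bottom spin $\Sigma'$, written $(L,\Sigma;L',\Sigma')$, is zero unless listed ($\Sigma_{>c},\Sigma_{<c},\Sigma_{(c,d)}$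 denote the elements of $\Sigma$ that are $>c$, $<c$, strictly between $c$ and $d$): (1) $(+,\Sigma;+,\Sigma)$: $(-t)^{|\Sigma|}$. (2) $(c,\Sigma;c,\Sigma)$: $t^{|\Sigma_{>c}|}(-xy^{-1}+t^{\delta})$ with $\delta=1$ if $c\in\Sigma$, else $0$. (3) $(+,\Sigma;c,\Sigma\setminus\{c\})$, $c\in\Sigma$: $(-t)^{|\Sigma_{<c}|}t^{|\Sigma_{>c}|}$. (4) $(c,\Sigma;+,\Sigma\cup\{c\})$, $c\notin\Sigma$: $-(1-t)xy^{-1}(-t)^{|\Sigma_{>c}|}$. (5) $(c,\Sigma;d,(\Sigma\cup\{c\})\setminus\{d\})$, $c<d$, $d\in\Sigma$, $c\notin\Sigma$: $-(1-t)xy^{-1}(-t)^{|\Sigma_{(c,d)}|}t^{|\Sigma_{>d}|}$. (6) $(d,\Sigma;c,(\Sigma\cup\{d\})\setminus\{c\})$, $c<d$, $c\in\Sigma$, $d\notin\Sigma$: $-(1-t)(-1)^{|\Sigma_{(c,d)}|}t^{|\Sigma_{>d}|}$. (At $t=0$ use $0^0=1$.) $Z^\square_{\sigma,w}(\boldsymbol{x};\boldsymbol{y})$ is the partition function, i.e. the sum over all assignments of spins to interior edges of the product of the vertex weights, with boundary conditions: the top boundary edge in column $j$ carries the single color $\sigma(j)$; the right boundary edge in row $i$ has color $w(i)$; left and bottom boundary edges are uncolored. *)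

theory Defs
  imports
    "HOL-Library.Poly_Mapping"
    "HOL-Library.FuncSet"
    "HOL-Combinatorics.Permutations"
    "HOL-Computational_Algebra.Polynomial"
begin

section \<open>The symmetric group as a Coxeter group\<close>

text \<open>
  Elements of \<open>S\<^sub>n\<close> are functions \<open>w\<close> with \<^prop>\<open>w permutes {1..n}\<close>, so that they are the
  identity outside \<open>{1..n}\<close>; the product is \<^term>\<open>(\<circ>)\<close>.
\<close>

definition simple_refl :: "nat \<Rightarrow> nat \<Rightarrow> nat" where
  "simple_refl i = transpose i (Suc i)"

definition longest :: "nat \<Rightarrow> nat \<Rightarrow> nat" where
  "longest n i = (if i \<in> {1..n} then n + 1 - i else i)"

definition len :: "nat \<Rightarrow> (nat \<Rightarrow> nat) \<Rightarrow> nat" where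
  "len n w = (LEAST k. \<exists>is. length is = k \<and> set is \<subseteq> {1..<n} \<and>
                           w = foldr (\<circ>) (map simple_refl is) id)"

definition bruhat_less :: "nat \<Rightarrow> (nat \<Rightarrow> nat) \<Rightarrow> (nat \<Rightarrow> nat) \<Rightarrow> bool" where
  "bruhat_less n = (\<lambda>u v. u permutes {1..n} \<and> v permutes {1..n} \<and>
      (\<exists>a\<in>{1..n}. \<exists>b\<in>{1..n}. a \<noteq> b \<and> v = u \<circ> transpose a b) \<and> len n u < len n v)\<^sup>+\<^sup>+"


section \<open>Laurent polynomials in \<open>x\<^sub>1, x\<^sub>2, \<dots>\<close> and \<open>y\<^sub>1, y\<^sub>2, \<dots>\<close>\<close>

datatype var = X nat | Y nat

text \<open>
  The order on variables plays no role in the definitions.  It is only needed to obtain, from the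
  instances for \<^type>\<open>poly_mapping\<close>, that the ring of Laurent polynomials is an integral domain.
\<close>

instantiation var :: linorder
begin

fun less_eq_var :: "var \<Rightarrow> var \<Rightarrow> bool" where
  "X i \<le> X j \<longleftrightarrow> i \<le> j"
| "X i \<le> Y j \<longleftrightarrow> True"
| "Y i \<le> X j \<longleftrightarrow> False"
| "Y i \<le> Y j \<longleftrightarrow> i \<le> j"

definition less_var :: "var \<Rightarrow> var \<Rightarrow> bool" where
  "less_var u v \<longleftrightarrow> u \<le> v \<and> \<not> v \<le> u"

instance
proof
  fix u v w :: var
  show "u < v \<longleftrightarrow> u \<le> v \<and> \<not> v \<le> u" by (rule less_var_def)
  show "u \<le> u" by (cases u) auto
  show "u \<le> w" if "u \<le> v" "v \<le> w" using that by (cases u; cases v; cases w) auto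
  show "u = v" if "u \<le> v" "v \<le> u" using that by (cases u; cases v) auto
  show "u \<le> v \<or> v \<le> u" by (cases u; cases v) auto
qed

end

text \<open>A Laurent polynomial maps exponent vectors (with integer entries) to coefficients.\<close>

type_synonym laurent = "(var \<Rightarrow>\<^sub>0 int) \<Rightarrow>\<^sub>0 int"

definition x_var :: "nat \<Rightarrow> laurent" where
  "x_var i = Poly_Mapping.single (Poly_Mapping.single (X i) 1) 1"

definition y_inv :: "nat \<Rightarrow> laurent" where
  "y_inv j = Poly_Mapping.single (Poly_Mapping.single (Y j) (- 1)) 1"

fun swap_var :: "nat \<Rightarrow> var \<Rightarrow> var" where
  "swap_var i (X k) = X (simple_refl i k)"
| "swap_var i (Y k) = Y k"

text \<open>
  The action of \<open>s\<^sub>i\<close>: \<^const>\<open>Poly_Mapping.map_key\<close> is precomposition, so the coefficient of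
  \<open>s\<^sub>i f\<close> at an exponent vector \<open>e\<close> is the coefficient of \<open>f\<close> at \<open>e \<circ> s\<^sub>i\<close>.
\<close>

definition swap_x :: "nat \<Rightarrow> laurent \<Rightarrow> laurent" where
  "swap_x i = Poly_Mapping.map_key (Poly_Mapping.map_key (swap_var i))"

lemma swap_var_involutive: "swap_var i (swap_var i v) = v"
  by (cases v) (simp_all add: simple_refl_def)

lemma inj_swap_var: "inj (swap_var i)"
  by (metis injI swap_var_involutive)

lemma inj_map_key_swap_var:
  "inj (Poly_Mapping.map_key (swap_var i) :: (var \<Rightarrow>\<^sub>0 int) \<Rightarrow> (var \<Rightarrow>\<^sub>0 int))"
proof (rule injI)
  fix p q :: "var \<Rightarrow>\<^sub>0 int"
  assume "Poly_Mapping.map_key (swap_var i) p = Poly_Mapping.map_key (swap_var i) q"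
  then have "Poly_Mapping.lookup p (swap_var i v) = Poly_Mapping.lookup q (swap_var i v)" for v
    by (metis map_key.rep_eq[OF inj_swap_var] comp_apply)
  then show "p = q"
    by (intro poly_mapping_eqI) (metis swap_var_involutive)
qed

lemma lookup_swap_x:
  "Poly_Mapping.lookup (swap_x i f) e = Poly_Mapping.lookup f (Poly_Mapping.map_key (swap_var i) e)"
  by (simp add: swap_x_def map_key.rep_eq[OF inj_map_key_swap_var])

lemma x_var_eq_iff: "x_var i = x_var j \<longleftrightarrow> i = j"
proof
  assume "x_var i = x_var j"
  then have "Poly_Mapping.lookup (x_var i) (Poly_Mapping.single (X i) 1) =
      Poly_Mapping.lookup (x_var j) (Poly_Mapping.single (X i) 1)" by simp
  then have "Poly_Mapping.single (X j) (1::int) = Poly_Mapping.single (X i) 1"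
    by (auto simp: x_var_def lookup_single when_def split: if_splits)
  then have "Poly_Mapping.lookup (Poly_Mapping.single (X j) (1::int)) (X i) = 1" by simp
  then show "i = j"
    by (auto simp: lookup_single when_def split: if_splits)
qed simp


section \<open>Double Grothendieck polynomials\<close>

text \<open>
  \<open>(x\<^sub>i\<^sub>+\<^sub>1 f - x\<^sub>i s\<^sub>i f) / (x\<^sub>i\<^sub>+\<^sub>1 - x\<^sub>i)\<close>, as the exact quotient in the ring of Laurent polynomials.
\<close>

definition demazure :: "nat \<Rightarrow> laurent \<Rightarrow> laurent" where
  "demazure i f =
     (THE g. (x_var (Suc i) - x_var i) * g = x_var (Suc i) * f - x_var i * swap_x i f)"

lemma demazure_eqI:
  assumes "(x_var (Suc i) - x_var i) * g = x_var (Suc i) * f - x_var i * swap_x i f"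
  shows "demazure i f = g"
  unfolding demazure_def
proof (rule the_equality)
  fix h
  assume "(x_var (Suc i) - x_var i) * h = x_var (Suc i) * f - x_var i * swap_x i f"
  with assms have "(x_var (Suc i) - x_var i) * h = (x_var (Suc i) - x_var i) * g" by simp
  then show "h = g" by (simp add: x_var_eq_iff)
qed (rule assms)

inductive grothendieck_rel :: "nat \<Rightarrow> (nat \<Rightarrow> nat) \<Rightarrow> laurent \<Rightarrow> bool" for n where
  longest: "grothendieck_rel n (longest n)
              (\<Prod>(i, j) | 1 \<le> i \<and> 1 \<le> j \<and> i + j \<le> n. 1 - x_var i * y_inv j)"
| descend: "grothendieck_rel n (w \<circ> simple_refl i) (demazure i f)"
    if "grothendieck_rel n w f" "i \<in> {1..<n}" "bruhat_less n (w \<circ> simple_refl i) w"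

text \<open>
  By the braid relations for \<^const>\<open>demazure\<close>, the relation is functional on \<open>S\<^sub>n\<close>.
\<close>

definition grothendieck :: "nat \<Rightarrow> (nat \<Rightarrow> nat) \<Rightarrow> laurent" where
  "grothendieck n w = (THE f. grothendieck_rel n w f)"


section \<open>The lattice model\<close>

text \<open>
  In a horizontal spin, \<^const>\<open>None\<close> stands for \<open>+\<close> (uncolored).  The arguments of the weight are
  \<open>t\<close>, \<open>z = x y\<^sup>-\<^sup>1\<close>, and the left, top, right and bottom spins, in this order.
\<close>

fun weight :: "'a::comm_ring_1 \<Rightarrow> 'a \<Rightarrow>
    nat option \<Rightarrow> nat set \<Rightarrow> nat option \<Rightarrow> nat set \<Rightarrow> 'a" where
  "weight t z None S None S' =
     (if S' = S then (- t) ^ card S else 0)"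
| "weight t z None S (Some c) S' =
     (if c \<in> S \<and> S' = S - {c}
      then (- t) ^ card {e \<in> S. e < c} * t ^ card {e \<in> S. e > c} else 0)"
| "weight t z (Some c) S None S' =
     (if c \<notin> S \<and> S' = S \<union> {c}
      then - (1 - t) * z * (- t) ^ card {e \<in> S. e > c} else 0)"
| "weight t z (Some a) S (Some b) S' =
     (if a = b then
        if S' = S
        then t ^ card {e \<in> S. e > a} * (- z + t ^ (if a \<in> S then 1 else 0)) else 0
      else if b \<in> S \<and> a \<notin> S \<and> S' = (S \<union> {a}) - {b} then
        if a < b
        then - (1 - t) * z * (- t) ^ card {e \<in> S. a < e \<and> e < b} * t ^ card {e \<in> S. e > b}
        else - (1 - t) * (- 1) ^ card {e \<in> S. b < e \<and> e < a} * t ^ card {e \<in> S. e > a}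
      else 0)"

text \<open>
  A state consists of the horizontal spins \<open>h\<close> and the vertical spins \<open>v\<close>.  Columns are numbered
  from right to left: \<open>h (i, j)\<close> is the edge in row \<open>i\<close> on the left of column \<open>j\<close> (and hence on
  the right of column \<open>j + 1\<close>), so \<open>h (i, 0)\<close> is on the right and \<open>h (i, n)\<close> on the left
  boundary; \<open>v (i, j)\<close> is the edge in column \<open>j\<close> below row \<open>i\<close>, so \<open>v (0, j)\<close> is on the top
  and \<open>v (n, j)\<close> on the bottom boundary.
\<close>

type_synonym state = "(nat \<times> nat \<Rightarrow> nat option) \<times> (nat \<times> nat \<Rightarrow> nat set)"

definition states :: "nat \<Rightarrow> (nat \<Rightarrow> nat) \<Rightarrow> (nat \<Rightarrow> nat) \<Rightarrow> state set" where
  "states n \<sigma> w =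
     {(h, v). h \<in> {1..n} \<times> {0..n} \<rightarrow>\<^sub>E insert None (Some ` {1..n}) \<and>
              v \<in> {0..n} \<times> {1..n} \<rightarrow>\<^sub>E Pow {1..n} \<and>
              (\<forall>j\<in>{1..n}. v (0, j) = {\<sigma> j}) \<and>
              (\<forall>i\<in>{1..n}. h (i, 0) = Some (w i)) \<and>
              (\<forall>i\<in>{1..n}. h (i, n) = None) \<and>
              (\<forall>j\<in>{1..n}. v (n, j) = {})}"

text \<open>
  The partition function is a polynomial in \<open>t = [:0, 1:]\<close> whose coefficients are Laurent
  polynomials in \<open>x\<close> and \<open>y\<close>.
\<close>

definition partition_function ::
    "nat \<Rightarrow> (nat \<Rightarrow> nat) \<Rightarrow> (nat \<Rightarrow> nat) \<Rightarrow> laurent poly" where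
  "partition_function n \<sigma> w =
     (\<Sum>(h, v)\<in>states n \<sigma> w. \<Prod>i\<in>{1..n}. \<Prod>j\<in>{1..n}.
        weight [:0, 1:] [:x_var i * y_inv j:] (h (i, j)) (v (i - 1, j)) (h (i, j - 1)) (v (i, j)))"

definition partition_function_t0 ::
    "nat \<Rightarrow> (nat \<Rightarrow> nat) \<Rightarrow> (nat \<Rightarrow> nat) \<Rightarrow> laurent" where
  "partition_function_t0 n \<sigma> w = poly (partition_function n \<sigma> w) 0"

end

theory Submission
  imports Defs
begin

text \<open>
  Why the theorem holds.  At \<open>t = 0\<close> a vertex whose bottom edge carries at most one color has
  nonzero weight only if its top edge carries at most one color (\<open>weight_0_thin\<close>).  As the bottom
  boundary is empty, a vertical edge of a state of nonzero weight carries at most one color, and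
  the surviving vertices are few.  An uncolored empty vertex stays so; an uncolored horizontal edge
  that meets a color lets it turn right; a horizontal color \<open>c\<close> that meets a vertical color
  \<open>e\<close> either crosses it, with weight \<open>1 - x/y\<close>, which is possible only for \<open>e < c\<close>, or is
  exchanged with it, with weight \<open>-1\<close> if \<open>e < c\<close> and \<open>-x/y\<close> otherwise.  So every row shortens
  the word of vertical colors by one letter: the first letter enters the row, walks through the
  others and possibly exchanges places with them, and the letter that arrives on the right is the
  color prescribed there.  Starting from the word \<open>n, \<dots>, 2, 1\<close> on the top boundary, the partition
  function becomes the sum \<open>lattice_sum\<close> over such walks.

  The recursion of Grothendieck polynomials is a relation between consecutive rows.  If the right
  boundary colors \<open>w(i) > w(i+1)\<close> of two rows are exchanged, then
  \<open>x\<^sub>i\<^sub>+\<^sub>1 Z(w) + (x\<^sub>i\<^sub>+\<^sub>1 - x\<^sub>i) Z(w s\<^sub>i) = x\<^sub>i s\<^sub>i Z(w)\<close>, that is, \<open>Z(w s\<^sub>i)\<close> is the negative of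
  the Demazure operator applied to \<open>Z(w)\<close> (\<open>demazure_lattice_sum\<close>).  This is the train argument of
  the Yang--Baxter equation: the operator \<open>exchange\<close>, acting on the pair of horizontal colors of
  two rows, is moved through the columns one at a time (\<open>two_rows_exchange\<close>), and the uncolored left
  boundary absorbs it (\<open>first_two_rows_exchange\<close>).

  For \<open>w\<^sub>0\<close> only the walks without any exchange of colors contribute, and their weights multiply to
  the product that defines the Grothendieck polynomial of \<open>w\<^sub>0\<close> (\<open>lattice_sum_longest\<close>).  Rule
  induction now shows that every Laurent polynomial that the descending recursion assigns to \<open>w\<close> is
  \<open>Z(w)\<close> up to the sign of \<open>w\<inverse> w\<^sub>0\<close>.  In particular it is unique; that one exists follows because
  every \<open>w \<noteq> w\<^sub>0\<close> has an ascent, and an ascent is a step up in Bruhat order since the Coxeter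
  length is the number of inversions.
\<close>

section \<open>Length, inversions and descents\<close>

definition inversions :: "nat \<Rightarrow> (nat \<Rightarrow> nat) \<Rightarrow> (nat \<times> nat) set" where
  "inversions n w = {(a, b). 1 \<le> a \<and> a < b \<and> b \<le> n \<and> w b < w a}"

lemma finite_inversions: "finite (inversions n w)"
  by (rule finite_subset[of _ "{..n} \<times> {..n}"]) (auto simp: inversions_def)

lemma simple_refl_involutive: "simple_refl i (simple_refl i k) = k"
  by (simp add: simple_refl_def)

lemma comp_simple_refl_twice: "w \<circ> simple_refl i \<circ> simple_refl i = w"
  by (simp add: fun_eq_iff simple_refl_involutive)

lemma simple_refl_permutes: "i \<in> {1..<n} \<Longrightarrow> simple_refl i permutes {1..n}"
  unfolding simple_refl_def by (rule permutes_swap_id) auto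

lemma comp_simple_refl_permutes:
  "w permutes {1..n} \<Longrightarrow> i \<in> {1..<n} \<Longrightarrow> w \<circ> simple_refl i permutes {1..n}"
  by (rule permutes_compose[OF simple_refl_permutes])

text \<open>
  Precomposing with \<open>s\<^sub>i\<close> renames positions, and \<open>s\<^sub>i\<close> preserves the order of every pair of
  positions except \<open>(i, i + 1)\<close>; hence all inversions persist and this one pair becomes new.
\<close>

lemma card_inversions_ascent:
  assumes i: "i \<in> {1..<n}" and asc: "w i < w (Suc i)"
  shows "card (inversions n (w \<circ> simple_refl i)) = Suc (card (inversions n w))"
proof -
  let ?s = "simple_refl i"
  have s_le: "?s a < ?s b" if "a < b" "(a, b) \<noteq> (i, Suc i)" for a b
    using that by (auto simp: simple_refl_def transpose_def)
  have s_range: "1 \<le> ?s a \<and> ?s a \<le> n \<longleftrightarrow> 1 \<le> a \<and> a \<le> n" for a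
    using i by (auto simp: simple_refl_def transpose_def)
  have image: "inversions n (w \<circ> ?s) = insert (i, Suc i) (map_prod ?s ?s ` inversions n w)"
  proof (intro set_eqI iffI)
    fix p assume p: "p \<in> inversions n (w \<circ> ?s)"
    obtain a b where ab: "p = (a, b)" by (cases p)
    show "p \<in> insert (i, Suc i) (map_prod ?s ?s ` inversions n w)"
    proof (cases "(a, b) = (i, Suc i)")
      case False
      then have "(?s a, ?s b) \<in> inversions n w"
        using p s_le[of a b] s_range[of a] s_range[of b] by (auto simp: ab inversions_def)
      then have "map_prod ?s ?s (?s a, ?s b) \<in> map_prod ?s ?s ` inversions n w" by (rule imageI)
      then show ?thesis by (simp add: ab simple_refl_involutive)
    qed (simp add: ab)
  next
    fix p assume "p \<in> insert (i, Suc i) (map_prod ?s ?s ` inversions n w)"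
    then consider "p = (i, Suc i)" | a b where "(a, b) \<in> inversions n w" "p = (?s a, ?s b)" by auto
    then show "p \<in> inversions n (w \<circ> ?s)"
    proof cases
      case 1
      then show ?thesis using i asc by (simp add: inversions_def) (simp add: simple_refl_def)
    next
      case 2
      then have "(a, b) \<noteq> (i, Suc i)" using asc by (auto simp: inversions_def)
      then show ?thesis using 2 s_le[of a b] s_range[of a] s_range[of b]
        by (auto simp: inversions_def simple_refl_involutive)
    qed
  qed
  have "(i, Suc i) \<notin> map_prod ?s ?s ` inversions n w"
  proof
    assume "(i, Suc i) \<in> map_prod ?s ?s ` inversions n w"
    then obtain a b where ab: "(a, b) \<in> inversions n w" "i = ?s a" "Suc i = ?s b" by auto
    then have "a = Suc i" "b = i" by (metis simple_refl_involutive simple_refl_def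
          transpose_apply_first transpose_apply_second)+
    then show False using ab by (simp add: inversions_def)
  qed
  moreover have "inj_on (map_prod ?s ?s) (inversions n w)"
    by (rule inj_onI) (metis map_prod_simp prod.collapse prod.inject simple_refl_involutive)
  ultimately show ?thesis
    unfolding image by (simp add: finite_inversions card_image)
qed

lemma card_inversions_descent:
  assumes "i \<in> {1..<n}" "w (Suc i) < w i"
  shows "Suc (card (inversions n (w \<circ> simple_refl i))) = card (inversions n w)"
proof -
  have "card (inversions n (w \<circ> simple_refl i \<circ> simple_refl i))
      = Suc (card (inversions n (w \<circ> simple_refl i)))"
    using assms by (intro card_inversions_ascent) (auto simp: simple_refl_def)
  then show ?thesis by (simp only: comp_simple_refl_twice)
qed

lemma permutes_neq_Suc:
  assumes "w permutes {1..n}" shows "w i \<noteq> w (Suc i)"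
  using permutes_inj[OF assms] by (simp add: inj_eq)

lemma increasing_permutes_imp_id:
  assumes w: "w permutes {1..n}" and inc: "\<And>i. i \<in> {1..<n} \<Longrightarrow> w i < w (Suc i)"
  shows "w = id"
proof
  fix i
  \<comment> \<open>The values \<open>w k\<close> dominate \<open>k\<close> and have the same sum, so they agree with it.\<close>
  have le: "k \<in> {1..n} \<Longrightarrow> k \<le> w k" for k
  proof (induction k)
    case (Suc k)
    show ?case
    proof (cases "k = 0")
      case True
      then show ?thesis using permutes_in_image[OF w, of "Suc k"] Suc.prems by simp
    next
      case False
      then show ?thesis using Suc inc[of k] by fastforce
    qed
  qed simp
  have "(\<Sum>k\<in>{1..n}. w k) = (\<Sum>k\<in>{1..n}. k)"
    using sum.permute[OF w, of "\<lambda>k. k"] by simp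
  then have "\<forall>k\<in>{1..n}. w k = k"
    using le sum_mono_inv[of "\<lambda>k. k" "{1..n}" w] by (metis finite_atLeastAtMost)
  then show "w i = id i" using permutes_not_in[OF w, of i] by (cases "i \<in> {1..n}") auto
qed

definition refl_product :: "nat list \<Rightarrow> nat \<Rightarrow> nat" where
  "refl_product is = foldr (\<circ>) (map simple_refl is) id"

lemma refl_product_Nil: "refl_product [] = id"
  by (simp add: refl_product_def id_def)

lemma refl_product_Cons: "refl_product (i # is) = simple_refl i \<circ> refl_product is"
  by (simp add: refl_product_def fun_eq_iff)

lemma refl_product_snoc: "refl_product (is @ [i]) = refl_product is \<circ> simple_refl i"
  by (induction "is") (simp_all add: refl_product_Nil refl_product_Cons comp_assoc)

lemma refl_product_permutes:
  "set is \<subseteq> {1..<n} \<Longrightarrow> refl_product is permutes {1..n}"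
  by (induction "is" rule: rev_induct)
    (auto simp: refl_product_snoc refl_product_Nil permutes_id 
      intro!: comp_simple_refl_permutes[simplified])

lemma card_inversions_le_length:
  "set is \<subseteq> {1..<n} \<Longrightarrow> card (inversions n (refl_product is)) \<le> length is"
proof (induction "is" rule: rev_induct)
  case Nil
  have "inversions n id = {}" by (auto simp: inversions_def)
  then show ?case by (simp only: refl_product_Nil card.empty)
next
  case (snoc i "is")
  let ?w = "refl_product is"
  have "?w i \<noteq> ?w (Suc i)"
    using snoc.prems by (intro permutes_neq_Suc[where n = n] refl_product_permutes) auto
  then have "card (inversions n (?w \<circ> simple_refl i)) \<le> Suc (card (inversions n ?w))"
    using card_inversions_ascent[of i n ?w] card_inversions_descent[of i n ?w] snoc.prems
    by (auto simp: neq_iff)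
  with snoc show ?case unfolding refl_product_snoc by (simp add: comp_def)
qed

text \<open>
  Bubble sort: removing a descent on the right lowers the number of inversions by one, and a
  permutation without descents is the identity.
\<close>

lemma reduced_word_exists:
  assumes "w permutes {1..n}"
  shows "\<exists>is. length is = card (inversions n w) \<and> set is \<subseteq> {1..<n} \<and>
           w = refl_product is"
  using assms
proof (induction "card (inversions n w)" arbitrary: w rule: less_induct)
  case less
  show ?case
  proof (cases "\<exists>i\<in>{1..<n}. w (Suc i) < w i")
    case True
    then obtain i where i: "i \<in> {1..<n}" "w (Suc i) < w i" by blast
    note desc = card_inversions_descent[of i n w, OF i]
    obtain "is" where "is": "length is = card (inversions n (w \<circ> simple_refl i))"
        "set is \<subseteq> {1..<n}" "w \<circ> simple_refl i = refl_product is"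
      using less.hyps[of "w \<circ> simple_refl i"] desc comp_simple_refl_permutes[OF less.prems i(1)]
      by auto
    have "w = refl_product (is @ [i])"
      unfolding refl_product_snoc by (simp only: "is"(3)[symmetric] comp_simple_refl_twice)
    moreover have "length (is @ [i]) = card (inversions n w)" "set (is @ [i]) \<subseteq> {1..<n}"
      using desc "is"(1,2) i(1) by auto
    ultimately show ?thesis by blast
  next
    case False
    then have "w i < w (Suc i)" if "i \<in> {1..<n}" for i
      using that permutes_neq_Suc[OF less.prems, of i] by (meson linorder_neqE_nat)
    then have "w = id" by (rule increasing_permutes_imp_id[OF less.prems])
    moreover from this have "inversions n w = {}" by (auto simp: inversions_def)
    ultimately show ?thesis by (intro exI[of _ "[]"]) (simp add: refl_product_Nil)
  qed
qed

lemma len_eq_card_inversions: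
  assumes "w permutes {1..n}"
  shows "len n w = card (inversions n w)"
  unfolding len_def refl_product_def[symmetric]
proof (rule Least_equality)
  show "\<exists>is. length is = card (inversions n w) \<and> set is \<subseteq> {1..<n} \<and>
           w = refl_product is"
    using assms by (rule reduced_word_exists)
qed (use card_inversions_le_length in blast)

lemma sign_simple_refl: "sign (simple_refl i) = - 1"
  by (simp add: simple_refl_def sign_swap_id)

lemma minus_one_power_len:
  assumes "w permutes {1..n}"
  shows "(- 1) ^ len n w = (of_int (sign w) :: 'a::ring_1)"
proof -
  obtain "is" where "is": "length is = card (inversions n w)" "set is \<subseteq> {1..<n}"
      "w = refl_product is"
    using reduced_word_exists[OF assms] by blast
  have "sign (refl_product is) = (- 1) ^ length is"
    if "set is \<subseteq> {1..<n}" for "is"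
    using that
  proof (induction "is")
    case (Cons i "is")
    have "permutation (simple_refl i)" by (simp add: simple_refl_def permutation_swap_id)
    moreover have "permutation (refl_product is)"
      using refl_product_permutes[of "is" n] Cons.prems
      by (intro permutation_permutes[THEN iffD2]) auto
    ultimately have "sign (refl_product (i # is)) = - sign (refl_product is)"
      unfolding refl_product_Cons by (subst sign_compose) (simp_all add: sign_simple_refl)
    then show ?case using Cons by simp
  qed (simp add: refl_product_Nil sign_id)
  from this[OF "is"(2)] show ?thesis
    by (simp add: len_eq_card_inversions[OF assms] "is"(1,3)[symmetric])
qed

lemma longest_permutes: "longest n permutes {1..n}"
  by (rule bij_imp_permutes)
    (auto simp: longest_def intro!: bij_betwI[where g = "longest n"])

lemma longest_involutive: "longest n \<circ> longest n = id"
  by (auto simp: longest_def fun_eq_iff)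

text \<open>
  Composition with \<open>w\<^sub>0\<close> turns decreasing permutations into increasing ones.
\<close>

lemma decreasing_permutes_imp_longest:
  assumes w: "w permutes {1..n}" and dec: "\<And>i. i \<in> {1..<n} \<Longrightarrow> w (Suc i) < w i"
  shows "w = longest n"
proof -
  have "longest n \<circ> w = id"
  proof (rule increasing_permutes_imp_id)
    show "longest n \<circ> w permutes {1..n}" using w longest_permutes by (rule permutes_compose)
    fix i assume i: "i \<in> {1..<n}"
    then have "w i \<in> {1..n}" "w (Suc i) \<in> {1..n}" by (simp_all only: permutes_in_image[OF w]) auto
    with dec[OF i] show "(longest n \<circ> w) i < (longest n \<circ> w) (Suc i)"
      by (auto simp: longest_def)
  qed
  then have "longest n \<circ> longest n \<circ> w = longest n" by (simp add: comp_assoc)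
  then show ?thesis by (simp add: longest_involutive)
qed

lemma bruhat_less_imp_len_less: "bruhat_less n u v \<Longrightarrow> len n u < len n v"
  unfolding bruhat_less_def by (induction rule: tranclp_induct) auto

lemma bruhat_less_ascent:
  assumes "w permutes {1..n}" "i \<in> {1..<n}" "w i < w (Suc i)"
  shows "bruhat_less n w (w \<circ> simple_refl i)"
proof -
  note w' = comp_simple_refl_permutes[OF assms(1,2)]
  have "\<exists>a\<in>{1..n}. \<exists>b\<in>{1..n}. a \<noteq> b \<and> w \<circ> simple_refl i = w \<circ> transpose a b"
    using assms(2) by (intro bexI[of _ i] bexI[of _ "Suc i"]) (auto simp: simple_refl_def)
  moreover have "len n w < len n (w \<circ> simple_refl i)"
    unfolding len_eq_card_inversions[OF assms(1)] len_eq_card_inversions[OF w']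
    using card_inversions_ascent[of i n w] assms(2,3) by simp
  ultimately show ?thesis
    unfolding bruhat_less_def using assms(1) w' by (intro tranclp.r_into_trancl) blast
qed

lemma bruhat_less_comp_simple_refl_imp_descent:
  assumes "w permutes {1..n}" "i \<in> {1..<n}" "bruhat_less n (w \<circ> simple_refl i) w"
  shows "w (Suc i) < w i"
proof (rule ccontr)
  assume "\<not> w (Suc i) < w i"
  then have "w i < w (Suc i)" using permutes_neq_Suc[OF assms(1), of i] by simp
  from bruhat_less_imp_len_less[OF bruhat_less_ascent[OF assms(1,2) this]]
    bruhat_less_imp_len_less[OF assms(3)]
  show False by simp
qed

text \<open>
  From \<open>w \<noteq> w\<^sub>0\<close> one climbs along an ascent, which creates an inversion; their number
  is at most \<open>n * n\<close>, so the climb ends, and it can end only at \<open>w\<^sub>0\<close>.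
\<close>

lemma grothendieck_rel_exists:
  assumes "w permutes {1..n}"
  shows "\<exists>f. grothendieck_rel n w f"
  using assms
proof (induction "n * n - card (inversions n w)" arbitrary: w rule: less_induct)
  case less
  show ?case
  proof (cases "\<exists>i\<in>{1..<n}. w i < w (Suc i)")
    case True
    then obtain i where i: "i \<in> {1..<n}" "w i < w (Suc i)" by blast
    note w' = comp_simple_refl_permutes[OF less.prems i(1)]
    have "inversions n (w \<circ> simple_refl i) \<subseteq> {1..n} \<times> {1..n}" by (auto simp: inversions_def)
    then have "card (inversions n (w \<circ> simple_refl i)) \<le> n * n"
      using card_mono[of "{1..n} \<times> {1..n}"] by (simp add: card_cartesian_product)
    then have "n * n - card (inversions n (w \<circ> simple_refl i)) < n * n - card (inversions n w)"
      using card_inversions_ascent[of i n w, OF i] by simp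
    then obtain f where "grothendieck_rel n (w \<circ> simple_refl i) f"
      using less.hyps w' by blast
    then have "grothendieck_rel n (w \<circ> simple_refl i \<circ> simple_refl i) (demazure i f)"
    proof (rule grothendieck_rel.descend)
      show "bruhat_less n (w \<circ> simple_refl i \<circ> simple_refl i) (w \<circ> simple_refl i)"
        using bruhat_less_ascent[OF less.prems i] by (simp only: comp_simple_refl_twice)
    qed (rule i(1))
    then show ?thesis by (auto simp only: comp_simple_refl_twice)
  next
    case False
    then have "w (Suc i) < w i" if "i \<in> {1..<n}" for i
      using that permutes_neq_Suc[OF less.prems, of i] by (meson linorder_neqE_nat)
    then have "w = longest n" by (rule decreasing_permutes_imp_longest[OF less.prems])
    then show ?thesis using grothendieck_rel.longest by blast
  qed
qed

section \<open>One row as a walk through a word\<close>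

text \<open>
  A row with parameter \<open>x\<close> in which the color \<open>c\<close> arrives from the left and meets the colors
  \<open>es\<close>, listed from left to right, on the top edges.  Since columns are numbered from right to left, the first entry of
  \<open>e # es\<close> stands in column \<open>length es + 1\<close>; the values of \<open>y\<close> are the \<open>y\<^sub>j\<inverse>\<close>.  The rest of the
  model enters as a continuation \<open>K\<close>: it receives the color \<open>d\<close> that leaves on the right and the
  colors \<open>r\<close> below the row.  In this form stacking rows is nesting of continuations, and
  linearity in \<open>K\<close> replaces the manipulation of sums over intermediate words.
\<close>

fun row_sum :: "'a::comm_ring_1 \<Rightarrow> (nat \<Rightarrow> 'a) \<Rightarrow> nat \<Rightarrow> nat list \<Rightarrow> (nat \<Rightarrow> nat list \<Rightarrow> 'a) \<Rightarrow> 'a" where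
  "row_sum x y c [] K = K c []"
| "row_sum x y c (e # es) K =
     (if e < c then
        (1 - x * y (Suc (length es))) * row_sum x y c es (\<lambda>d r. K d (e # r))
        - row_sum x y e es (\<lambda>d r. K d (c # r))
      else - (x * y (Suc (length es))) * row_sum x y e es (\<lambda>d r. K d (c # r)))"

lemma row_sum_add:
  "row_sum x y c es (\<lambda>d r. K d r + L d r) = row_sum x y c es K + row_sum x y c es L"
  by (induction es arbitrary: c K L) (simp_all add: algebra_simps)

lemma row_sum_mult: "row_sum x y c es (\<lambda>d r. a * K d r) = a * row_sum x y c es K"
  by (induction es arbitrary: c K) (simp_all add: algebra_simps)

lemma row_sum_zero: "row_sum x y c es (\<lambda>d r. 0) = 0"
  using row_sum_mult[of x y c es 0 "\<lambda>d r. 0"] by simp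

lemma row_sum_uminus: "row_sum x y c es (\<lambda>d r. - K d r) = - row_sum x y c es K"
  using row_sum_mult[of x y c es "-1" K] by simp

lemma row_sum_diff:
  "row_sum x y c es (\<lambda>d r. K d r - L d r) = row_sum x y c es K - row_sum x y c es L"
  using row_sum_add[of x y c es K "\<lambda>d r. - L d r"] by (simp add: row_sum_uminus)

text \<open>
  A row permutes the colors that enter it.
\<close>

lemma row_sum_cong:
  assumes "\<And>d r. mset (d # r) = mset (c # es) \<Longrightarrow> K d r = L d r"
  shows "row_sum x y c es K = row_sum x y c es L"
  using assms
proof (induction es arbitrary: c K L)
  case (Cons e es)
  have "row_sum x y c es (\<lambda>d r. K d (e # r)) = row_sum x y c es (\<lambda>d r. L d (e # r))"
    by (rule Cons.IH) (auto intro!: Cons.prems)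
  moreover have "row_sum x y e es (\<lambda>d r. K d (c # r)) = row_sum x y e es (\<lambda>d r. L d (c # r))"
    by (rule Cons.IH) (auto intro!: Cons.prems)
  ultimately show ?case by simp
qed auto

section \<open>The exchange relation for two rows\<close>

definition two_rows where
  "two_rows x x' y c c' es K = row_sum x y c es (\<lambda>d r. row_sum x' y c' r (K d))"

lemma two_rows_Nil: "two_rows x x' y c c' [] K = K c c' []"
  by (simp add: two_rows_def)

text \<open>
  Two stacked rows can be evaluated column by column instead of row by row: the first letter of
  the word between them is known after the first column.
\<close>

lemma two_rows_Cons:
  fixes x x' :: "'a::comm_ring_1" and y
  defines "z \<equiv> \<lambda>es. x * y (Suc (length es))" and "z' \<equiv> \<lambda>es. x' * y (Suc (length es))"
  shows "two_rows x x' y c c' (e # es) K =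
    (let D = \<lambda>b b' a. two_rows x x' y b b' es (\<lambda>d d' r. K d d' (a # r));
         V = \<lambda>b a. if a < c' then (1 - z' es) * D b c' a - D b a c' else - z' es * D b a c'
     in if e < c then (1 - z es) * V c e - V e c else - z es * V e c)"
proof -
  have len: "row_sum x y b es (\<lambda>d r. row_sum x' y c' (a # r) (K d)) =
      (let D = \<lambda>b b' a. two_rows x x' y b b' es (\<lambda>d d' r. K d d' (a # r))
       in if a < c' then (1 - z' es) * D b c' a - D b a c' else - z' es * D b a c')" for a b
  proof -
    have "row_sum x y b es (\<lambda>d r. row_sum x' y c' (a # r) (K d)) =
      row_sum x y b es (\<lambda>d r. 
       if a < c' then
        (1 - z' es) * row_sum x' y c' r (\<lambda>d' r. K d d' (a # r))
        - row_sum x' y a r (\<lambda>d' r. K d d' (c' # r))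
      else - z' es * row_sum x' y a r (\<lambda>d' r. K d d' (c' # r)))"
    proof (rule row_sum_cong)
      fix d r assume "mset (d # r) = mset (b # es)"
      then have "length r = length es" by (metis length_Cons mset_eq_length nat.inject)
      then show "row_sum x' y c' (a # r) (K d) = (if a < c' then
        (1 - z' es) * row_sum x' y c' r (\<lambda>d' r. K d d' (a # r))
        - row_sum x' y a r (\<lambda>d' r. K d d' (c' # r))
      else - z' es * row_sum x' y a r (\<lambda>d' r. K d d' (c' # r)))"
        by (simp add: z'_def)
    qed
    then show ?thesis
      by (cases "a < c'")
        (simp_all only: two_rows_def Let_def row_sum_diff row_sum_mult if_True if_False)
  qed
  have "two_rows x x' y c c' (e # es) K =
    (let V = \<lambda>b a. row_sum x y b es (\<lambda>d r. row_sum x' y c' (a # r) (K d))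
     in if e < c then (1 - z es) * V c e - V e c else - z es * V e c)"
    by (simp add: two_rows_def z_def Let_def)
  then show ?thesis by (simp only: len Let_def)
qed

text \<open>
  The action of the R-matrix on the pair of colors \<open>(d, d')\<close> that leave two adjacent rows,
  dualized to continuations.  It is read off from \<open>x' * [a, b] + (x' - x) * [b, a] = x * s [a, b]\<close>
  for \<open>b < a\<close>, the shape of the Demazure recursion, where \<open>[a, b]\<close> is the sum with right boundary
  \<open>(a, b)\<close> and \<open>s\<close> swaps the parameters \<open>x, x'\<close>, together with the symmetry of \<open>[b, a]\<close> under \<open>s\<close>.
\<close>

definition exchange :: "'a::comm_ring_1 \<Rightarrow> 'a \<Rightarrow> (nat \<Rightarrow> nat \<Rightarrow> 'b \<Rightarrow> 'a) \<Rightarrow> nat \<Rightarrow> nat \<Rightarrow> 'b \<Rightarrow> 'a" where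
  "exchange x x' K d d' r =
     (if d' < d then x' * K d d' r else (x' - x) * K d' d r + x * K d d' r)"

text \<open>
  The Yang--Baxter equation: applying \<open>exchange\<close> on the right of the columns \<open>es\<close> amounts to
  swapping the parameters of the two rows and applying the same matrix on the left.  By induction
  it suffices to pass one column.  There only the relative order of the three colors involved
  matters, and each of the three positions of \<open>e\<close> gives a polynomial identity.
\<close>

lemma two_rows_exchange:
  assumes "distinct (p # q # es)" "q < p"
  shows "two_rows x x' y p q es (exchange x x' K) = x' * two_rows x' x y p q es K"
    and "two_rows x x' y q p es (exchange x x' K) =
           (x' - x) * two_rows x' x y p q es K + x * two_rows x' x y q p es K"
  using assms
proof (induction es arbitrary: p q K)
  case Nil
  { case 1 then show ?case by (simp add: two_rows_Nil exchange_def) }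
  { case 2 then show ?case by (simp add: two_rows_Nil exchange_def) }
next
  case (Cons e es)
  have shift: "(\<lambda>d d' r. exchange x x' K d d' (a # r)) = exchange x x' (\<lambda>d d' r. K d d' (a # r))"
    for a and K :: "nat \<Rightarrow> nat \<Rightarrow> nat list \<Rightarrow> 'a"
    by (auto simp: exchange_def fun_eq_iff)
  have IH:
    "two_rows x x' y a b es (\<lambda>d d' r. exchange x x' K d d' (c # r)) =
       x' * two_rows x' x y a b es (\<lambda>d d' r. K d d' (c # r))"
    "two_rows x x' y b a es (\<lambda>d d' r. exchange x x' K d d' (c # r)) =
       (x' - x) * two_rows x' x y a b es (\<lambda>d d' r. K d d' (c # r))
       + x * two_rows x' x y b a es (\<lambda>d d' r. K d d' (c # r))"
    if "b < a" "a \<notin> set es" "b \<notin> set es" "distinct es" for a b c K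
    unfolding shift using that by (auto intro: Cons.IH)
  { case 1
    then consider "e < q" | "q < e" "e < p" | "p < e" by fastforce
    then show ?case
      using 1 by cases (simp_all add: two_rows_Cons Let_def IH algebra_simps) }
  { case 2
    then consider "e < q" | "q < e" "e < p" | "p < e" by fastforce
    then show ?case
      using 2 by cases (simp_all add: two_rows_Cons Let_def IH algebra_simps) }
qed

section \<open>Sums over all rows\<close>

text \<open>
  The rows \<open>i, i + 1, \<dots>\<close> with right boundary colors \<open>ws\<close> below a word \<open>u\<close>: in every
  row the first letter of the word turns into the row, which costs nothing, and the rest of the
  word loses that column.
\<close>

primrec word_sum ::
    "(nat \<Rightarrow> 'a::comm_ring_1) \<Rightarrow> (nat \<Rightarrow> 'a) \<Rightarrow> nat list \<Rightarrow> nat \<Rightarrow> nat list \<Rightarrow> 'a" where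
  "word_sum x y [] i u = 1"
| "word_sum x y (c # ws) i u = (case u of [] \<Rightarrow> 0 | e # es \<Rightarrow>
     row_sum (x i) y e es (\<lambda>d r. if d = c then word_sum x y ws (Suc i) r else 0))"

lemma word_sum_cong:
  assumes "\<And>j. i \<le> j \<Longrightarrow> x j = x' j"
  shows "word_sum x y ws i u = word_sum x' y ws i u"
  using assms
proof (induction ws arbitrary: i u)
  case (Cons c ws)
  have "word_sum x y ws (Suc i) r = word_sum x' y ws (Suc i) r" for r
    using Cons by simp
  then show ?case using Cons.prems[of i] by (simp cong: if_cong split: list.split)
qed simp

text \<open>
  Two adjacent rows including their left ends: the first letter of the word produced by the upper
  row turns into the lower row.
\<close>

definition first_two_rows where
  "first_two_rows x x' y c es K = row_sum x y c es
     (\<lambda>d r. case r of [] \<Rightarrow> 0 | e # r' \<Rightarrow> row_sum x' y e r' (K d))"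

lemma first_two_rows_Cons:
  "first_two_rows x x' y c (e # es) K =
     (if e < c then
        (1 - x * y (Suc (length es))) * two_rows x x' y c e es K - two_rows x x' y e c es K
      else - (x * y (Suc (length es))) * two_rows x x' y e c es K)"
  by (simp add: first_two_rows_def two_rows_def)

text \<open>
  On the left of the other columns the two rows carry \<open>c\<close> and \<open>e\<close>, in one of the two orders, with
  coefficients from the single vertex where they meet.  These coefficients form an eigenvector of
  the R-matrix up to the swap of \<open>x\<close> and \<open>x'\<close>, so that the matrix disappears at the left
  boundary.
\<close>

lemma first_two_rows_exchange:
  assumes "distinct (c # e # es)"
  shows "first_two_rows x x' y c (e # es) (exchange x x' K)
         = x * first_two_rows x' x y c (e # es) K"
proof (cases "e < c")
  case True
  then show ?thesis
    using assms by (simp add: first_two_rows_Cons two_rows_exchange algebra_simps)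
next
  case False
  then have "c < e" using assms by auto
  then show ?thesis
    using assms by (simp add: first_two_rows_Cons two_rows_exchange algebra_simps)
qed

lemma first_two_rows_add:
  "first_two_rows x x' y c (e # es) (\<lambda>d d' r. a * K d d' r + b * L d d' r) =
     a * first_two_rows x x' y c (e # es) K + b * first_two_rows x x' y c (e # es) L"
  by (simp add: first_two_rows_Cons two_rows_def row_sum_add row_sum_mult algebra_simps)

lemma word_sum_Cons_Cons:
  "word_sum x y (a # b # vs) i (c # e # es) =
     first_two_rows (x i) (x (Suc i)) y c (e # es)
       (\<lambda>d d' r. if d = a \<and> d' = b then word_sum x y vs (Suc (Suc i)) r else 0)"
proof -
  have "(\<lambda>d r. if d = a then word_sum x y (b # vs) (Suc i) r else 0) =
    (\<lambda>d r. case r of [] \<Rightarrow> 0 | e # r' \<Rightarrow> row_sum (x (Suc i)) y e r'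
       (\<lambda>d' r. if d = a \<and> d' = b then word_sum x y vs (Suc (Suc i)) r else 0))"
    by (auto simp: fun_eq_iff row_sum_zero split: list.split)
  then show ?thesis by (simp only: word_sum.simps(2)[of x y a] list.case first_two_rows_def)
qed

text \<open>
  Neither the rows above \<open>k\<close> nor those below \<open>k + 1\<close> involve \<open>x\<^sub>k\<close> or \<open>x\<^sub>k\<^sub>+\<^sub>1\<close>, and the rows above
  act linearly on what follows, so that the identity reduces to the two rows with right colors
  \<open>a, b\<close>.
\<close>

lemma word_sum_swap:
  assumes "distinct u" "length u = length us + length vs + 2" "b < a" "k = i + length us"
  shows "x (Suc k) * word_sum x y (us @ a # b # vs) i u
         + (x (Suc k) - x k) * word_sum x y (us @ b # a # vs) i u
         = x k * word_sum (x \<circ> transpose k (Suc k)) y (us @ a # b # vs) i u"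
  using assms
proof (induction us arbitrary: i u)
  case Nil
  then obtain c e es where u: "u = c # e # es"
    by (metis Suc_length_conv add_2_eq_Suc' list.size(3) add.left_neutral)
  define K where "K = (\<lambda>d d' r. if d = a \<and> d' = b then word_sum x y vs (Suc (Suc i)) r else 0)"
  define L where "L = (\<lambda>d d' r. if d = b \<and> d' = a then word_sum x y vs (Suc (Suc i)) r else 0)"
  have "word_sum (x \<circ> transpose i (Suc i)) y vs (Suc (Suc i)) r
      = word_sum x y vs (Suc (Suc i)) r" for r
    by (rule word_sum_cong) (simp add: transpose_def)
  then have swapped: "word_sum (x \<circ> transpose i (Suc i)) y ([] @ a # b # vs) i u
      = first_two_rows (x (Suc i)) (x i) y c (e # es) K"
    by (simp add: u word_sum_Cons_Cons K_def del: word_sum.simps cong: if_cong)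
  have unswapped:
    "word_sum x y ([] @ a # b # vs) i u = first_two_rows (x i) (x (Suc i)) y c (e # es) K"
    "word_sum x y ([] @ b # a # vs) i u = first_two_rows (x i) (x (Suc i)) y c (e # es) L"
    by (simp_all add: u word_sum_Cons_Cons K_def L_def del: word_sum.simps cong: if_cong)
  \<comment> \<open>For a continuation that prescribes \<open>(a, b)\<close> the R-matrix yields the left side of the claim.\<close>
  have "exchange (x i) (x (Suc i)) K
      = (\<lambda>d d' r. x (Suc i) * K d d' r + (x (Suc i) - x i) * L d d' r)"
    using Nil(3) by (auto simp: fun_eq_iff exchange_def K_def L_def)
  then have "x (Suc i) * first_two_rows (x i) (x (Suc i)) y c (e # es) K
      + (x (Suc i) - x i) * first_two_rows (x i) (x (Suc i)) y c (e # es) L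
      = first_two_rows (x i) (x (Suc i)) y c (e # es) (exchange (x i) (x (Suc i)) K)"
    by (simp only: first_two_rows_add)
  also have "\<dots> = x i * first_two_rows (x (Suc i)) (x i) y c (e # es) K"
    using Nil(1) by (intro first_two_rows_exchange) (simp add: u)
  finally show ?case
    using Nil(4) by (simp only: swapped unswapped list.size(3) add_0_right)
next
  case (Cons c us)
  from Cons.prems obtain e es where u: "u = e # es" by (cases u) auto
  define W where "W = (\<lambda>x' ws d r. if d = c then word_sum x' y ws (Suc i) r else 0)"
  have W: "word_sum x' y (c # ws) i u = row_sum (x' i) y e es (W x' ws)" for x' ws
    by (simp add: u W_def)
  have "x (Suc k) * row_sum (x i) y e es (W x (us @ a # b # vs))
       + (x (Suc k) - x k) * row_sum (x i) y e es (W x (us @ b # a # vs))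
    = row_sum (x i) y e es (\<lambda>d r. x (Suc k) * W x (us @ a # b # vs) d r
         + (x (Suc k) - x k) * W x (us @ b # a # vs) d r)"
    by (simp add: row_sum_add row_sum_mult)
  also have "\<dots> = row_sum (x i) y e es (\<lambda>d r. x k * W (x \<circ> transpose k (Suc k)) (us @ a # b # vs) d r)"
  proof (rule row_sum_cong)
    fix d r assume eq: "mset (d # r) = mset (e # es)"
    then have "distinct (d # r)" "length (d # r) = length (e # es)"
      using Cons.prems(1) u mset_eq_imp_distinct_iff mset_eq_length by metis+
    then have "distinct r" "length r = length us + length vs + 2"
      using Cons.prems(2) u by auto
    then have "x (Suc k) * word_sum x y (us @ a # b # vs) (Suc i) r
       + (x (Suc k) - x k) * word_sum x y (us @ b # a # vs) (Suc i) r
       = x k * word_sum (x \<circ> transpose k (Suc k)) y (us @ a # b # vs) (Suc i) r"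
      using Cons.prems by (intro Cons.IH) auto
    then show "x (Suc k) * W x (us @ a # b # vs) d r
         + (x (Suc k) - x k) * W x (us @ b # a # vs) d r
        = x k * W (x \<circ> transpose k (Suc k)) (us @ a # b # vs) d r"
      by (simp add: W_def)
  qed
  also have "\<dots> = x k * row_sum (x i) y e es (W (x \<circ> transpose k (Suc k)) (us @ a # b # vs))"
    by (rule row_sum_mult)
  finally show ?case
    using Cons.prems(4) unfolding append_Cons W by simp
qed

lemma row_sum_hom:
  assumes "\<And>a b. \<phi> (a + b) = \<phi> a + \<phi> b" "\<And>a b. \<phi> (a * b) = \<phi> a * \<phi> b" "\<phi> 1 = 1"
  shows "\<phi> (row_sum x y c es K) = row_sum (\<phi> x) (\<phi> \<circ> y) c es (\<lambda>d r. \<phi> (K d r))"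
proof -
  interpret additive \<phi> by standard (rule assms(1))
  show ?thesis
    by (induction es arbitrary: c K) (simp_all add: assms minus diff)
qed

lemma word_sum_hom:
  assumes "\<And>a b. \<phi> (a + b) = \<phi> a + \<phi> b" "\<And>a b. \<phi> (a * b) = \<phi> a * \<phi> b" "\<phi> 1 = 1"
  shows "\<phi> (word_sum x y ws i u) = word_sum (\<phi> \<circ> x) (\<phi> \<circ> y) ws i u"
proof -
  interpret additive \<phi> by standard (rule assms(1))
  show ?thesis
    by (induction ws arbitrary: i u)
      (auto simp: assms(3) zero row_sum_hom[of \<phi>, OF assms] if_distrib[of \<phi>]
            cong: if_cong split: list.split)
qed

text \<open>
  A color that has been exchanged for another one stays in its column for the rest of the row.
  So the maximal color can leave on the right only if it crosses all others.
\<close>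

lemma row_sum_stay:
  assumes "\<forall>e\<in>set es. e < c" "\<And>d r. d \<noteq> c \<Longrightarrow> K d r = 0"
  shows "row_sum x y c es K = (\<Prod>j = 1..length es. 1 - x * y j) * K c es"
  using assms
proof (induction es arbitrary: K)
  case (Cons e es)
  have "row_sum x y e es (\<lambda>d r. K d (c # r)) = row_sum x y e es (\<lambda>d r. 0)"
  proof (rule row_sum_cong)
    fix d r assume "mset (d # r) = mset (e # es)"
    then have "d \<in> set (e # es)" by (metis list.set_intros(1) mset_eq_setD)
    then have "d \<noteq> c" using Cons.prems(1) by auto
    then show "K d (c # r) = 0" by (rule Cons.prems(2))
  qed
  moreover have "row_sum x y c es (\<lambda>d r. K d (e # r))
      = (\<Prod>j = 1..length es. 1 - x * y j) * K c (e # es)"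
    using Cons.prems by (intro Cons.IH) auto
  ultimately show ?case
    using Cons.prems(1) by (simp add: row_sum_zero algebra_simps)
qed simp

text \<open>
  Here each row must pass on its first letter, the largest one.
\<close>

lemma word_sum_longest:
  assumes "i + m = Suc n"
  shows "word_sum x y (rev [1..<Suc m]) i (rev [1..<Suc m]) =
    (\<Prod>(k, j) | i \<le> k \<and> 1 \<le> j \<and> k + j \<le> n. 1 - x k * y j)"
  using assms
proof (induction m arbitrary: i)
  case 0
  then have empty: "{(k, j). i \<le> k \<and> 1 \<le> j \<and> k + j \<le> n} = {}" by auto
  show ?case unfolding empty by simp
next
  case (Suc m)
  let ?T = "\<lambda>i. {(k, j). i \<le> k \<and> 1 \<le> j \<and> k + j \<le> n}"
  \<comment> \<open>Row \<open>i\<close> contributes the pairs with first entry \<open>i\<close>.\<close>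
  have T: "?T i = {i} \<times> {1..m} \<union> ?T (Suc i)"
    using Suc.prems by (auto simp: Suc_le_eq)
  have fin: "finite (?T (Suc i))"
    by (rule finite_subset[of _ "{..n} \<times> {..n}"]) auto
  have "word_sum x y (rev [1..<Suc (Suc m)]) i (rev [1..<Suc (Suc m)]) =
     row_sum (x i) y (Suc m) (rev [1..<Suc m])
       (\<lambda>d r. if d = Suc m then word_sum x y (rev [1..<Suc m]) (Suc i) r else 0)"
    unfolding upt_Suc[of 1 "Suc m"] by (simp del: upt_Suc cong: if_cong)
  also have "\<dots> = (\<Prod>j = 1..m. 1 - x i * y j) * word_sum x y (rev [1..<Suc m]) (Suc i) (rev [1..<Suc m])"
    by (subst row_sum_stay) auto
  also have "\<dots> = (\<Prod>(k, j)\<in>{i} \<times> {1..m}. 1 - x k * y j) * (\<Prod>(k, j)\<in>?T (Suc i). 1 - x k * y j)"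
    using Suc by (simp add: prod.cartesian_product[symmetric])
  also have "\<dots> = (\<Prod>(k, j)\<in>?T i. 1 - x k * y j)"
    unfolding T by (rule prod.union_disjoint[symmetric]) (use fin in auto)
  finally show ?case .
qed

section \<open>The Demazure recursion\<close>

lemma swap_x_add: "swap_x i (f + g) = swap_x i f + swap_x i g"
  by (rule poly_mapping_eqI) (simp add: lookup_swap_x lookup_add)

lemma swap_x_single:
  "swap_x i (Poly_Mapping.single e c) = Poly_Mapping.single (Poly_Mapping.map_key (swap_var i) e) c"
proof (rule poly_mapping_eqI)
  fix e'
  have invol: "Poly_Mapping.map_key (swap_var i) (Poly_Mapping.map_key (swap_var i) p) = p"
    for p :: "var \<Rightarrow>\<^sub>0 int"
    by (rule poly_mapping_eqI) (simp add: map_key.rep_eq[OF inj_swap_var] swap_var_involutive)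
  then have "e = Poly_Mapping.map_key (swap_var i) e' \<longleftrightarrow> Poly_Mapping.map_key (swap_var i) e = e'"
    by metis
  then show "Poly_Mapping.lookup (swap_x i (Poly_Mapping.single e c)) e' =
      Poly_Mapping.lookup (Poly_Mapping.single (Poly_Mapping.map_key (swap_var i) e) c) e'"
    by (simp add: lookup_swap_x lookup_single when_def)
qed

lemma swap_x_zero: "swap_x i 0 = 0"
  using swap_x_add[of i 0 0] by simp

text \<open>
  Polynomial mappings are generated additively by monomials, which reduces the multiplicativity of
  \<open>swap_x\<close> to a product of two monomials.
\<close>

lemma poly_mapping_plus_induct [case_names zero plus]:
  fixes f :: "'a \<Rightarrow>\<^sub>0 'b::comm_monoid_add"
  assumes "P 0" "\<And>k c g. P g \<Longrightarrow> P (Poly_Mapping.single k c + g)"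
  shows "P f"
proof (induction f rule: update_induct)
  case (update g k c)
  then have "Poly_Mapping.update k c g = Poly_Mapping.single k c + g"
    by (intro poly_mapping_eqI)
      (auto simp: lookup_update lookup_add lookup_single when_def in_keys_iff)
  then show ?case using assms(2)[OF update.IH] by simp
qed (rule assms(1))

lemma swap_x_mult: "swap_x i (f * g) = swap_x i f * swap_x i g"
proof -
  have *: "swap_x i (Poly_Mapping.single e c * g) = swap_x i (Poly_Mapping.single e c) * swap_x i g" for e c
    by (induction g rule: poly_mapping_plus_induct)
      (simp_all add: swap_x_add swap_x_zero swap_x_single mult_single map_key_plus[OF inj_swap_var] distrib_left)
  show ?thesis
    by (induction f rule: poly_mapping_plus_induct)
      (simp_all add: swap_x_add swap_x_zero * distrib_right)
qed

lemma swap_x_one: "swap_x i 1 = 1"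
proof -
  have "Poly_Mapping.map_key (swap_var i) 0 = (0 :: var \<Rightarrow>\<^sub>0 int)"
    by (rule poly_mapping_eqI) (simp add: map_key.rep_eq[OF inj_swap_var])
  then show ?thesis by (simp add: swap_x_single flip: single_one)
qed

lemma swap_x_uminus: "swap_x i (- f) = - swap_x i f"
  using swap_x_add[of i f "- f"] by (simp add: swap_x_zero eq_neg_iff_add_eq_0 add.commute)

lemma map_key_swap_var_single:
  "Poly_Mapping.map_key (swap_var i) (Poly_Mapping.single (swap_var i v) c) = Poly_Mapping.single v c"
  by (rule map_key_single[OF inj_swap_var])

lemma swap_x_x_var: "swap_x i (x_var k) = x_var (simple_refl i k)"
  using map_key_swap_var_single[of i "X (simple_refl i k)" "1::int"]
  unfolding x_var_def swap_x_single by (simp add: simple_refl_involutive)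

lemma swap_x_y_inv: "swap_x i (y_inv k) = y_inv k"
  using map_key_swap_var_single[of i "Y k" "-1::int"]
  unfolding y_inv_def swap_x_single by simp

text \<open>
  The partition function at \<open>t = 0\<close> in terms of words: the colors on the top boundary read
  \<open>n, \<dots>, 1\<close> from left to right.
\<close>

definition lattice_sum :: "nat \<Rightarrow> (nat \<Rightarrow> nat) \<Rightarrow> laurent" where
  "lattice_sum n w = word_sum x_var y_inv (map w [1..<Suc n]) 1 (rev [1..<Suc n])"

lemma swap_x_lattice_sum:
  "swap_x i (lattice_sum n w) =
     word_sum (x_var \<circ> transpose i (Suc i)) y_inv (map w [1..<Suc n]) 1 (rev [1..<Suc n])"
proof -
  have "swap_x i \<circ> x_var = x_var \<circ> transpose i (Suc i)" "swap_x i \<circ> y_inv = y_inv"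
    by (simp_all add: fun_eq_iff swap_x_x_var swap_x_y_inv simple_refl_def)
  then show ?thesis
    using word_sum_hom[of "swap_x i", OF swap_x_add swap_x_mult swap_x_one, of x_var y_inv]
    by (simp add: lattice_sum_def del: upt_Suc)
qed

lemma lattice_sum_descent:
  assumes i: "i \<in> {1..<n}" and desc: "w (Suc i) < w i"
  shows "x_var (Suc i) * lattice_sum n w
      + (x_var (Suc i) - x_var i) * lattice_sum n (w \<circ> simple_refl i)
      = x_var i * swap_x i (lattice_sum n w)"
proof -
  define us vs where "us = map w [1..<i]" and "vs = map w [Suc (Suc i)..<Suc n]"
  have "[1..<Suc n] = [1..<i] @ [i..<Suc n]"
    using i upt_add_eq_append[of 1 i "Suc n - i"] by auto
  also have "[i..<Suc n] = i # Suc i # [Suc (Suc i)..<Suc n]"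
    using i upt_conv_Cons[of i "Suc n"] upt_conv_Cons[of "Suc i" "Suc n"] by auto
  finally have split: "[1..<Suc n] = [1..<i] @ i # Suc i # [Suc (Suc i)..<Suc n]" .
  have w: "map w [1..<Suc n] = us @ w i # w (Suc i) # vs"
    unfolding split us_def vs_def by simp
  have "map (w \<circ> simple_refl i) [1..<i] = us"
    "map (w \<circ> simple_refl i) [Suc (Suc i)..<Suc n] = vs"
    by (auto simp: us_def vs_def simple_refl_def transpose_def simp del: upt_Suc)
  then have ws: "map (w \<circ> simple_refl i) [1..<Suc n] = us @ w (Suc i) # w i # vs"
    unfolding split by (simp add: simple_refl_def)
  show ?thesis
    unfolding swap_x_lattice_sum unfolding lattice_sum_def w ws
  proof (rule word_sum_swap)
    show "distinct (rev [1..<Suc n])" by (simp del: upt_Suc)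
    show "length (rev [1..<Suc n]) = length us + length vs + 2" "i = 1 + length us"
      using i by (auto simp: us_def vs_def)
  qed (rule desc)
qed

lemma demazure_lattice_sum:
  assumes "i \<in> {1..<n}" "w (Suc i) < w i"
  shows "demazure i (lattice_sum n w) = - lattice_sum n (w \<circ> simple_refl i)"
  using lattice_sum_descent[OF assms] by (intro demazure_eqI) (simp add: algebra_simps)

lemma demazure_uminus_lattice_sum:
  assumes "i \<in> {1..<n}" "w (Suc i) < w i"
  shows "demazure i (- lattice_sum n w) = lattice_sum n (w \<circ> simple_refl i)"
  using lattice_sum_descent[OF assms]
  by (intro demazure_eqI) (simp add: swap_x_uminus algebra_simps)

lemma lattice_sum_longest:
  "lattice_sum n (longest n)
     = (\<Prod>(i, j) | 1 \<le> i \<and> 1 \<le> j \<and> i + j \<le> n. 1 - x_var i * y_inv j)"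
proof -
  have "map (longest n) [1..<Suc n] = rev [1..<Suc n]"
    by (rule nth_equalityI) (auto simp: rev_nth longest_def simp del: upt_Suc)
  then show ?thesis unfolding lattice_sum_def by (simp only: word_sum_longest[of 1 n n])
qed

text \<open>
  Passing from \<open>w\<close> to \<open>w s\<^sub>i\<close> multiplies \<open>w\<inverse> w\<^sub>0\<close> by \<open>s\<^sub>i\<close> on the left, so the sign changes along
  with the one in \<open>demazure_lattice_sum\<close>.
\<close>

lemma grothendieck_rel_lattice_sum:
  assumes "grothendieck_rel n w f"
  shows "w permutes {1..n} \<and> lattice_sum n w = of_int (sign (inv w \<circ> longest n)) * f"
  using assms
proof induction
  case longest
  have "inv (longest n) = longest n"
    using inv_unique_comp[of "longest n" "longest n"] longest_involutive by blast
  then show ?case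
    using longest_permutes lattice_sum_longest by (simp add: longest_involutive sign_id)
next
  case (descend w f i)
  then have w: "w permutes {1..n}" by simp
  note w' = comp_simple_refl_permutes[OF w descend.hyps(2)]
  have desc: "w (Suc i) < w i"
    using bruhat_less_comp_simple_refl_imp_descent[OF w] descend.hyps by blast
  have perm: "permutation (simple_refl i)" "permutation (inv w \<circ> longest n)"
    using permutes_compose[OF longest_permutes permutes_inv[OF w]]
      simple_refl_permutes[OF descend.hyps(2)] permutation_permutes by blast+
  have "inv (w \<circ> simple_refl i) = simple_refl i \<circ> inv w"
    using permutes_bij[OF w] permutes_bij[OF simple_refl_permutes[OF descend.hyps(2)]]
    by (simp add: o_inv_distrib simple_refl_def)
  then have "inv (w \<circ> simple_refl i) \<circ> longest n = simple_refl i \<circ> (inv w \<circ> longest n)"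
    by (simp add: comp_assoc)
  then have "sign (inv (w \<circ> simple_refl i) \<circ> longest n) = - sign (inv w \<circ> longest n)"
    by (simp only: sign_compose[OF perm] sign_simple_refl)
  moreover have "sign (inv w \<circ> longest n) = 1 \<or> sign (inv w \<circ> longest n) = -1"
    by (simp add: sign_def)
  moreover have "lattice_sum n w = of_int (sign (inv w \<circ> longest n)) * f"
    using descend.IH by blast
  ultimately have "lattice_sum n (w \<circ> simple_refl i)
      = of_int (sign (inv (w \<circ> simple_refl i) \<circ> longest n)) * demazure i f"
    using demazure_lattice_sum[OF descend.hyps(2) desc]
      demazure_uminus_lattice_sum[OF descend.hyps(2) desc] by auto
  with w' show ?case by blast
qed

lemma lattice_sum_eq_grothendieck:
  assumes "w permutes {1..n}"
  shows "lattice_sum n w = (- 1) ^ len n (inv w \<circ> longest n) * grothendieck n w"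
proof -
  let ?u = "inv w \<circ> longest n"
  have u: "?u permutes {1..n}"
    by (rule permutes_compose[OF longest_permutes permutes_inv[OF assms]])
  have determined: "f = of_int (sign ?u) * lattice_sum n w" if "grothendieck_rel n w f" for f
    using grothendieck_rel_lattice_sum[OF that] by (auto simp: sign_def)
  obtain f where f: "grothendieck_rel n w f" using grothendieck_rel_exists[OF assms] ..
  then have "grothendieck n w = f"
    unfolding grothendieck_def
    by (rule the_equality) (rule trans[OF determined determined[OF f, symmetric]])
  then show ?thesis
    using grothendieck_rel_lattice_sum[OF f] by (simp only: minus_one_power_len[OF u])
qed

section \<open>Summing over states vertex by vertex\<close>

text \<open>
  Vertices are named by row and column.  In a state \<open>(h, v)\<close> the left and bottom edges of a vertex
  \<open>p\<close> are \<open>h p\<close> and \<open>v p\<close>.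
\<close>

definition right_edge :: "nat \<times> nat \<Rightarrow> nat \<times> nat" where
  "right_edge p = (fst p, snd p - 1)"

definition top_edge :: "nat \<times> nat \<Rightarrow> nat \<times> nat" where
  "top_edge p = (fst p - 1, snd p)"

type_synonym 'a vertex_weight =
  "nat \<times> nat \<Rightarrow> nat option \<Rightarrow> nat set \<Rightarrow> nat option \<Rightarrow> nat set \<Rightarrow> 'a"

type_synonym hspins = "nat \<times> nat \<Rightarrow> nat option"
type_synonym vspins = "nat \<times> nat \<Rightarrow> nat set"

text \<open>
  Visiting the vertices in the order of a list, choose at each one the spins \<open>R\<close> and \<open>S\<close> of its
  outgoing edges, on the right and at the bottom.  Every edge outside the left and top
  boundary leaves exactly one vertex, so this enumerates all states; the boundary conditions on
  the right and at the bottom are put into the final weight \<open>B\<close>.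
\<close>

primrec sweep :: "'a::comm_ring_1 vertex_weight \<Rightarrow> nat option set \<Rightarrow> nat set set \<Rightarrow>
    (hspins \<Rightarrow> vspins \<Rightarrow> 'a) \<Rightarrow> (nat \<times> nat) list \<Rightarrow> hspins \<Rightarrow> vspins \<Rightarrow> 'a" where
  "sweep W A Q B [] h v = B h v"
| "sweep W A Q B (p # ps) h v =
     (\<Sum>R\<in>A. \<Sum>S\<in>Q. W p (h p) (v (top_edge p)) R S
        * sweep W A Q B ps (h(right_edge p := R)) (v(p := S)))"

primrec completions :: "nat option set \<Rightarrow> nat set set \<Rightarrow> (nat \<times> nat) list \<Rightarrow> hspins \<Rightarrow> vspins \<Rightarrow> state set"
where
  "completions A Q [] h v = {(h, v)}"
| "completions A Q (p # ps) h v =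
     (\<Union>R\<in>A. \<Union>S\<in>Q. completions A Q ps (h(right_edge p := R)) (v(p := S)))"

lemma finite_completions: "finite A \<Longrightarrow> finite Q \<Longrightarrow> finite (completions A Q ps h v)"
  by (induction ps arbitrary: h v) auto

lemma mem_completions_iff:
  "(h', v') \<in> completions A Q ps h v \<longleftrightarrow>
     (\<forall>e. if e \<in> right_edge ` set ps then h' e \<in> A else h' e = h e) \<and>
     (\<forall>p. if p \<in> set ps then v' p \<in> Q else v' p = v p)"
proof (induction ps arbitrary: h v)
  case (Cons p ps)
  show ?case
  proof
    assume "(h', v') \<in> completions A Q (p # ps) h v"
    then obtain R S where RS: "R \<in> A" "S \<in> Q"
      "(h', v') \<in> completions A Q ps (h(right_edge p := R)) (v(p := S))" by auto
    have "if e \<in> right_edge ` set (p # ps) then h' e \<in> A else h' e = h e" for e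
      using RS(1) RS(3)[unfolded Cons.IH, THEN conjunct1, rule_format, of e]
      by (auto split: if_splits)
    moreover have "if q \<in> set (p # ps) then v' q \<in> Q else v' q = v q" for q
      using RS(2) RS(3)[unfolded Cons.IH, THEN conjunct2, rule_format, of q]
      by (auto split: if_splits)
    ultimately show "(\<forall>e. if e \<in> right_edge ` set (p # ps) then h' e \<in> A else h' e = h e) \<and>
     (\<forall>q. if q \<in> set (p # ps) then v' q \<in> Q else v' q = v q)"
      by blast
  next
    assume *: "(\<forall>e. if e \<in> right_edge ` set (p # ps) then h' e \<in> A else h' e = h e) \<and>
     (\<forall>q. if q \<in> set (p # ps) then v' q \<in> Q else v' q = v q)"
    have "if e \<in> right_edge ` set ps then h' e \<in> A
        else h' e = (h(right_edge p := h' (right_edge p))) e" for e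
      using *[THEN conjunct1, rule_format, of e] by (auto split: if_splits)
    moreover have "if q \<in> set ps then v' q \<in> Q else v' q = (v(p := v' p)) q" for q
      using *[THEN conjunct2, rule_format, of q] by (auto split: if_splits)
    ultimately have
      "(h', v') \<in> completions A Q ps (h(right_edge p := h' (right_edge p))) (v(p := v' p))"
      unfolding Cons.IH by blast
    moreover have "h' (right_edge p) \<in> A" "v' p \<in> Q"
      using *[THEN conjunct1, rule_format, of "right_edge p"]
        *[THEN conjunct2, rule_format, of p] by auto
    ultimately show "(h', v') \<in> completions A Q (p # ps) h v" by auto
  qed
qed (auto simp: fun_eq_iff)

text \<open>
  The weight of a vertex is evaluated when it is visited.  This is its weight in the final state if
  no later step changes one of its four edges and its own outgoing edges are not incoming ones.
\<close>

primrec reading_order :: "(nat \<times> nat) list \<Rightarrow> bool" where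
  "reading_order [] \<longleftrightarrow> True"
| "reading_order (p # ps) \<longleftrightarrow> reading_order ps \<and>
     p \<notin> set ps \<and> right_edge p \<notin> right_edge ` set ps \<and>
     p \<notin> right_edge ` set (p # ps) \<and> top_edge p \<notin> set (p # ps)"

definition local_weight :: "'a::comm_ring_1 vertex_weight \<Rightarrow> hspins \<Rightarrow> vspins \<Rightarrow> nat \<times> nat \<Rightarrow> 'a" where
  "local_weight W h v p = W p (h p) (v (top_edge p)) (h (right_edge p)) (v p)"

lemma sweep_eq_sum:
  assumes "finite A" "finite Q" "reading_order ps"
  shows "sweep W A Q B ps h v =
    (\<Sum>(h', v')\<in>completions A Q ps h v. (\<Prod>p\<in>set ps. local_weight W h' v' p) * B h' v')"
  using assms(3)
proof (induction ps arbitrary: h v)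
  case (Cons p ps)
  let ?C = "\<lambda>R S. completions A Q ps (h(right_edge p := R)) (v(p := S))"
  let ?f = "\<lambda>ps (h', v'). (\<Prod>p\<in>set ps. local_weight W h' v' p) * B h' v'"
  have fixed: "h' (right_edge p) = R" "v' p = S" "h' p = h p" "v' (top_edge p) = v (top_edge p)"
    if "(h', v') \<in> ?C R S" for h' v' R S
  proof -
    have "\<forall>e. if e \<in> right_edge ` set ps then h' e \<in> A else h' e = (h(right_edge p := R)) e"
      "\<forall>q. if q \<in> set ps then v' q \<in> Q else v' q = (v(p := S)) q"
      using that unfolding mem_completions_iff by blast+
    from this(1)[rule_format, of "right_edge p"] this(1)[rule_format, of p]
      this(2)[rule_format, of p] this(2)[rule_format, of "top_edge p"] Cons.prems
    show "h' (right_edge p) = R" "v' p = S" "h' p = h p" "v' (top_edge p) = v (top_edge p)"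
      by (auto split: if_splits)
  qed
  have "(\<Sum>s\<in>completions A Q (p # ps) h v. ?f (p # ps) s)
      = (\<Sum>R\<in>A. \<Sum>s\<in>(\<Union>S\<in>Q. ?C R S). ?f (p # ps) s)"
    unfolding completions.simps using assms(1,2)
    by (intro sum.UNION_disjoint) (auto simp: finite_completions dest: fixed(1))
  also have "\<dots> = (\<Sum>R\<in>A. \<Sum>S\<in>Q. \<Sum>s\<in>?C R S. ?f (p # ps) s)"
    using assms(1,2)
    by (intro sum.cong[OF refl] sum.UNION_disjoint) (auto simp: finite_completions dest: fixed(2))
  also have "\<dots> = (\<Sum>R\<in>A. \<Sum>S\<in>Q. W p (h p) (v (top_edge p)) R S * (\<Sum>s\<in>?C R S. ?f ps s))"
  proof (intro sum.cong[OF refl])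
    fix R S
    show "(\<Sum>s\<in>?C R S. ?f (p # ps) s) = W p (h p) (v (top_edge p)) R S * (\<Sum>s\<in>?C R S. ?f ps s)"
      unfolding sum_distrib_left
    proof (rule sum.cong[OF refl])
      fix s assume s: "s \<in> ?C R S"
      obtain h' v' where "s = (h', v')" by (cases s)
      with fixed[of h' v' R S] s Cons.prems
      show "?f (p # ps) s = W p (h p) (v (top_edge p)) R S * ?f ps s"
        by (simp add: local_weight_def mult.assoc)
    qed
  qed
  also have "\<dots> = sweep W A Q B (p # ps) h v"
    using Cons by simp
  finally show ?case ..
qed simp

section \<open>Vertices and rows at t = 0\<close>

definition spins :: "nat \<Rightarrow> nat option set" where
  "spins n = insert None (Some ` {1..n})"

text \<open>
  The values that vertical edges take in states of nonzero weight at \<open>t = 0\<close>.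
\<close>

definition thin_sets :: "nat \<Rightarrow> nat set set" where
  "thin_sets n = {S. S \<subseteq> {1..n} \<and> card S \<le> 1}"

lemma finite_spins: "finite (spins n)"
  by (simp add: spins_def)

lemma finite_thin_sets: "finite (thin_sets n)"
  by (rule finite_subset[of _ "Pow {1..n}"]) (auto simp: thin_sets_def)

lemma in_thin_sets: "{} \<in> thin_sets n" "c \<in> {1..n} \<Longrightarrow> {c} \<in> thin_sets n"
  by (auto simp: thin_sets_def)

lemma pair_notin_thin_sets: "c \<noteq> e \<Longrightarrow> {c, e} \<notin> thin_sets n"
  by (simp add: thin_sets_def)

lemma sum_sum_support:
  fixes g :: "'b \<Rightarrow> 'c \<Rightarrow> 'a::comm_monoid_add"
  assumes "finite A" "finite Q" "T \<subseteq> A \<times> Q"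
    and "\<And>R S. R \<in> A \<Longrightarrow> S \<in> Q \<Longrightarrow> (R, S) \<notin> T \<Longrightarrow> g R S = 0"
  shows "(\<Sum>R\<in>A. \<Sum>S\<in>Q. g R S) = (\<Sum>(R, S)\<in>T. g R S)"
  unfolding sum.cartesian_product
  by (rule sum.mono_neutral_right) (use assms in auto)

lemma card_empty_filter: "card {e. e = c \<and> P e} = (if P c then 1 else 0)"
proof -
  have "{e. e = c \<and> P e} = (if P c then {c} else {})" by auto
  then show ?thesis by simp
qed

lemma vertex_sum_empty:
  "(\<Sum>R\<in>spins n. \<Sum>S\<in>thin_sets n. weight 0 z None {} R S * F R S) = F None {}"
proof -
  have "(\<Sum>R\<in>spins n. \<Sum>S\<in>thin_sets n. weight 0 z None {} R S * F R S)
     = (\<Sum>(R, S)\<in>{(None, {})}. weight 0 z None {} R S * F R S)"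
  proof (rule sum_sum_support[OF finite_spins finite_thin_sets])
    fix R :: "nat option" and S assume "(R, S) \<notin> {(None, {} :: nat set)}"
    then show "weight 0 z None {} R S * F R S = 0" by (cases R) auto
  qed (auto simp: spins_def in_thin_sets)
  then show ?thesis by simp
qed

lemma vertex_sum_turn:
  assumes "c \<in> {1..n}"
  shows "(\<Sum>R\<in>spins n. \<Sum>S\<in>thin_sets n. weight 0 z None {c} R S * F R S) = F (Some c) {}"
proof -
  have "(\<Sum>R\<in>spins n. \<Sum>S\<in>thin_sets n. weight 0 z None {c} R S * F R S)
     = (\<Sum>(R, S)\<in>{(Some c, {})}. weight 0 z None {c} R S * F R S)"
  proof (rule sum_sum_support[OF finite_spins finite_thin_sets])
    fix R S assume "(R, S) \<notin> {(Some c, {} :: nat set)}"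
    then show "weight 0 z None {c} R S * F R S = 0" by (cases R) auto
  qed (use assms in \<open>auto simp: spins_def in_thin_sets\<close>)
  then show ?thesis by (simp add: card_empty_filter)
qed

text \<open>
  The color cannot leave the row here: that would put two colors on the bottom edge.
\<close>

lemma vertex_sum_meet:
  assumes "c \<in> {1..n}" "e \<in> {1..n}"
  shows "(\<Sum>R\<in>spins n. \<Sum>S\<in>thin_sets n. weight 0 z (Some c) {e} R S * F R S) =
    (if e < c then (1 - z) * F (Some c) {e} - F (Some e) {c} else - z * F (Some e) {c})"
proof -
  have "(\<Sum>R\<in>spins n. \<Sum>S\<in>thin_sets n. weight 0 z (Some c) {e} R S * F R S)
     = (\<Sum>(R, S)\<in>{(Some c, {e}), (Some e, {c})}. weight 0 z (Some c) {e} R S * F R S)"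
  proof (rule sum_sum_support[OF finite_spins finite_thin_sets])
    fix R S assume "S \<in> thin_sets n" and RS: "(R, S) \<notin> {(Some c, {e}), (Some e, {c})}"
    then have "\<not> (c \<noteq> e \<and> S = {e} \<union> {c})" using pair_notin_thin_sets[of c e n] by auto
    with RS show "weight 0 z (Some c) {e} R S * F R S = 0"
      by (cases R) (auto simp: insert_Diff_if)
  qed (use assms in \<open>auto simp: spins_def in_thin_sets\<close>)
  also have "\<dots> = (if e < c then (1 - z) * F (Some c) {e} - F (Some e) {c} else - z * F (Some e) {c})"
    by (cases "c = e") (auto simp: card_empty_filter insert_Diff_if algebra_simps)
  finally show ?thesis .
qed

text \<open>
  The columns \<open>length es, \<dots>, 1\<close> carry the single colors \<open>es\<close>, in this order.
\<close>

fun col_word :: "(nat \<Rightarrow> nat set) \<Rightarrow> nat list \<Rightarrow> bool" where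
  "col_word f [] \<longleftrightarrow> True"
| "col_word f (e # es) \<longleftrightarrow> f (Suc (length es)) = {e} \<and> col_word f es"

lemma col_word_cong:
  "(\<And>j. 1 \<le> j \<Longrightarrow> j \<le> length es \<Longrightarrow> f j = g j) \<Longrightarrow> col_word f es \<longleftrightarrow> col_word g es"
  by (induction es) auto

context
  fixes n :: nat and x y :: "nat \<Rightarrow> 'a::comm_ring_1" and B :: "hspins \<Rightarrow> vspins \<Rightarrow> 'a"
begin

abbreviation "thin_sweep \<equiv> sweep (\<lambda>(i, j). weight 0 (x i * y j)) (spins n) (thin_sets n) B"

text \<open>
  The columns whose color has already turned into an earlier row are passed without effect.  The
  premise \<open>rest\<close> says that the remaining sweep has the value \<open>r\<close> for all spins that may result.
\<close>

lemma sweep_row_empty: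
  assumes "1 \<le> i" "m \<le> k" "h (i, k) = None" "\<And>j. m < j \<Longrightarrow> j \<le> k \<Longrightarrow> v (i - 1, j) = {}"
    and rest: "\<And>h' v'. h' (i, m) = None \<Longrightarrow> (\<And>j. m < j \<Longrightarrow> j \<le> k \<Longrightarrow> v' (i, j) = {}) \<Longrightarrow>
      (\<And>j. k < j \<Longrightarrow> v' (i, j) = v (i, j)) \<Longrightarrow>
      (\<And>i' j. i' \<noteq> i \<Longrightarrow> h' (i', j) = h (i', j) \<and> v' (i', j) = v (i', j)) \<Longrightarrow>
      thin_sweep ps h' v' = r"
  shows "thin_sweep (map (Pair i) (rev [Suc m..<Suc k]) @ ps) h v = r"
  using assms(2-)
proof (induction k arbitrary: h v)
  case 0
  then show ?case by simp
next
  case (Suc k)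
  show ?case
  proof (cases "m = Suc k")
    case True
    then show ?thesis using Suc.prems by simp
  next
    case False
    with Suc.prems have mk: "m \<le> k" by simp
    have "thin_sweep (map (Pair i) (rev [Suc m..<Suc (Suc k)]) @ ps) h v
      = thin_sweep (map (Pair i) (rev [Suc m..<Suc k]) @ ps)
          (h((i, k) := None)) (v((i, Suc k) := {}))"
      using mk Suc.prems(2) Suc.prems(3)[of "Suc k"]
      by (simp add: vertex_sum_empty top_edge_def right_edge_def)
    also have "\<dots> = r"
    proof (rule Suc.IH)
      show "m \<le> k" by (rule mk)
      fix h' v'
      assume *: "h' (i, m) = None" "\<And>j. m < j \<Longrightarrow> j \<le> k \<Longrightarrow> v' (i, j) = {}"
        "\<And>j. k < j \<Longrightarrow> v' (i, j) = (v((i, Suc k) := {})) (i, j)"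
        "\<And>i' j. i' \<noteq> i \<Longrightarrow> h' (i', j) = (h((i, k) := None)) (i', j) \<and>
           v' (i', j) = (v((i, Suc k) := {})) (i', j)"
      show "thin_sweep ps h' v' = r"
      proof (rule Suc.prems(4))
        show "v' (i, j) = {}" if "m < j" "j \<le> Suc k" for j
          using that *(2,3)[of j] by (cases "j = Suc k") auto
      qed (use * in auto)
    qed (use assms(1) Suc.prems(3) in auto)
    finally show ?thesis .
  qed
qed

text \<open>
  The colored part of a row is the walk summed by \<open>row_sum\<close>; its continuation \<open>K\<close> is the value of
  the remaining sweep, as a function of the outgoing color and the new word.
\<close>

lemma sweep_row_word:
  assumes "1 \<le> i" "col_word (\<lambda>j. v (i - 1, j)) es" "h (i, length es) = Some c" "set (c # es) \<subseteq> {1..n}"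
    and rest: "\<And>h' v' d r. h' (i, 0) = Some d \<Longrightarrow> col_word (\<lambda>j. v' (i, j)) r \<Longrightarrow>
      length r = length es \<Longrightarrow> set (d # r) \<subseteq> {1..n} \<Longrightarrow>
      (\<And>j. length es < j \<Longrightarrow> v' (i, j) = v (i, j)) \<Longrightarrow>
      (\<And>i' j. i' \<noteq> i \<Longrightarrow> h' (i', j) = h (i', j) \<and> v' (i', j) = v (i', j)) \<Longrightarrow>
      thin_sweep ps h' v' = K d r"
  shows "thin_sweep (map (Pair i) (rev [1..<Suc (length es)]) @ ps) h v = row_sum (x i) y c es K"
  using assms(2-)
proof (induction es arbitrary: h v c K)
  case Nil
  have "thin_sweep ps h v = K c []"
    by (rule Nil.prems(4)) (use Nil.prems in auto)
  then show ?case by simp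
next
  case (Cons e es)
  let ?l = "length es"
  have step: "thin_sweep (map (Pair i) (rev [1..<Suc ?l]) @ ps)
       (h((i, ?l) := Some b)) (v((i, Suc ?l) := {a})) = row_sum (x i) y b es (\<lambda>d r. K d (a # r))"
    if ab: "a \<in> {1..n}" "b \<in> {1..n}" for a b
  proof (rule Cons.IH)
    show "col_word (\<lambda>j. (v((i, Suc ?l) := {a})) (i - 1, j)) es"
      using Cons.prems(1) assms(1) by (auto cong: col_word_cong)
    fix h' v' d r
    assume *: "h' (i, 0) = Some d" "col_word (\<lambda>j. v' (i, j)) r" "length r = ?l" "set (d # r) \<subseteq> {1..n}"
      "\<And>j. ?l < j \<Longrightarrow> v' (i, j) = (v((i, Suc ?l) := {a})) (i, j)"
      "\<And>i' j. i' \<noteq> i \<Longrightarrow> h' (i', j) = (h((i, ?l) := Some b)) (i', j) \<and>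
         v' (i', j) = (v((i, Suc ?l) := {a})) (i', j)"
    show "thin_sweep ps h' v' = K d (a # r)"
      by (rule Cons.prems(4)) (use * ab in auto)
  qed (use Cons.prems(3) ab in auto)
  have ce: "c \<in> {1..n}" "e \<in> {1..n}" using Cons.prems(3) by auto
  have "thin_sweep (map (Pair i) (rev [1..<Suc (length (e # es))]) @ ps) h v
    = (\<Sum>R\<in>spins n. \<Sum>S\<in>thin_sets n. weight 0 (x i * y (Suc ?l)) (Some c) {e} R S *
        thin_sweep (map (Pair i) (rev [1..<Suc ?l]) @ ps)
          (h((i, ?l) := R)) (v((i, Suc ?l) := S)))"
    using Cons.prems(1,2) by (simp add: top_edge_def right_edge_def)
  also have "\<dots> = row_sum (x i) y c (e # es) K"
    by (simp only: vertex_sum_meet[OF ce] step[OF ce] step[OF ce(2,1)] row_sum.simps)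
  finally show ?case .
qed

end

definition grid_rows :: "nat \<Rightarrow> nat \<Rightarrow> (nat \<times> nat) list" where
  "grid_rows n i = concat (map (\<lambda>i. map (Pair i) (rev [1..<Suc n])) [i..<Suc n])"

lemma grid_rows_end: "grid_rows n (Suc n) = []"
  by (simp add: grid_rows_def)

lemma grid_rows_step: "i \<le> n \<Longrightarrow> grid_rows n i = map (Pair i) (rev [1..<Suc n]) @ grid_rows n (Suc i)"
  by (simp add: grid_rows_def upt_conv_Cons del: upt_Suc)

definition boundary :: "nat \<Rightarrow> (nat \<Rightarrow> nat) \<Rightarrow> hspins \<Rightarrow> vspins \<Rightarrow> bool" where
  "boundary n w h v \<longleftrightarrow> (\<forall>i\<in>{1..n}. h (i, 0) = Some (w i)) \<and> (\<forall>j\<in>{1..n}. v (n, j) = {})"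

text \<open>
  After \<open>p\<close> rows the \<open>p\<close> leftmost columns are empty.  The next row passes them, then lets the first
  letter of \<open>u\<close> turn right, and then walks through the rest of \<open>u\<close>.
\<close>

lemma sweep_rows:
  fixes x y :: "nat \<Rightarrow> 'a::comm_ring_1"
  assumes "p + length u = n" "col_word (\<lambda>j. v (p, j)) u" "set u \<subseteq> {1..n}"
    "\<And>j. j \<in> {length u<..n} \<Longrightarrow> v (p, j) = {}" "\<And>i. i \<in> {p<..n} \<Longrightarrow> h (i, n) = None"
  shows "thin_sweep n x y (\<lambda>h v. of_bool (boundary n w h v)) (grid_rows n (Suc p)) h v =
    (if \<forall>i\<in>{1..p}. h (i, 0) = Some (w i)
     then word_sum x y (map w [Suc p..<Suc n]) (Suc p) u else 0)"
  using assms
proof (induction "length u" arbitrary: p u h v)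
  case 0
  then show ?case by (auto simp: grid_rows_end boundary_def)
next
  case (Suc m)
  from Suc.hyps(2) obtain c es where u: "u = c # es" "length es = m"
    by (metis length_Suc_conv)
  let ?B = "\<lambda>h v. of_bool (boundary n w h v) :: 'a"
  let ?i = "Suc p"
  let ?K = "\<lambda>d r. if d = w ?i
     then if \<forall>i\<in>{1..p}. h (i, 0) = Some (w i)
          then word_sum x y (map w [Suc ?i..<Suc n]) (Suc ?i) r else 0
     else 0"
  have n: "n = ?i + m" using Suc.prems(1) u by simp
  have cols: "rev [1..<Suc n] = rev [Suc (Suc m)..<Suc n] @ Suc m # rev [1..<Suc m]"
    using upt_add_eq_append[of 1 "Suc (Suc m)" p] n by (simp add: add.commute del: upt_Suc)
      (simp add: upt_Suc)
  have first_row: "grid_rows n ?i = map (Pair ?i) (rev [Suc (Suc m)..<Suc n])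
      @ ((?i, Suc m) # map (Pair ?i) (rev [1..<Suc m]) @ grid_rows n (Suc ?i))"
    using n unfolding grid_rows_step[of ?i n, OF le_add1[of ?i m, folded n]] cols
    by (simp del: upt_Suc)
  have "thin_sweep n x y ?B (map (Pair ?i) (rev [Suc (Suc m)..<Suc n])
      @ ((?i, Suc m) # map (Pair ?i) (rev [1..<Suc m]) @ grid_rows n (Suc ?i))) h v
    = row_sum (x ?i) y c es ?K"
  proof (rule sweep_row_empty)
    show "h (?i, n) = None" using Suc.prems(5) n by simp
    show "v (?i - 1, j) = {}" if "Suc m < j" "j \<le> n" for j
      using Suc.prems(4)[of j] that u by simp
    fix h1 v1
    assume 1: "h1 (?i, Suc m) = None" "\<And>j. Suc m < j \<Longrightarrow> j \<le> n \<Longrightarrow> v1 (?i, j) = {}"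
      "\<And>j. n < j \<Longrightarrow> v1 (?i, j) = v (?i, j)"
      "\<And>i' j. i' \<noteq> ?i \<Longrightarrow> h1 (i', j) = h (i', j) \<and> v1 (i', j) = v (i', j)"
    have v1: "v1 (p, j) = v (p, j)" for j using 1(4)[of p] by simp
    have "thin_sweep n x y ?B ((?i, Suc m) # map (Pair ?i) (rev [1..<Suc m]) @ grid_rows n (Suc ?i)) h1 v1
      = thin_sweep n x y ?B (map (Pair ?i) (rev [1..<Suc m]) @ grid_rows n (Suc ?i))
          (h1((?i, m) := Some c)) (v1((?i, Suc m) := {}))"
      using Suc.prems(2,3) u 1(1) by (simp add: top_edge_def right_edge_def vertex_sum_turn v1)
    also have "\<dots> = row_sum (x ?i) y c es ?K"
      unfolding u(2)[symmetric]
    proof (rule sweep_row_word)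
      show "col_word (\<lambda>j. (v1((?i, Suc (length es)) := {})) (?i - 1, j)) es"
        using Suc.prems(2) u by (simp add: v1)
      fix h2 v2 d r
      assume 2: "h2 (?i, 0) = Some d" "col_word (\<lambda>j. v2 (?i, j)) r" "length r = length es"
        "set (d # r) \<subseteq> {1..n}"
        "\<And>j. length es < j \<Longrightarrow> v2 (?i, j) = (v1((?i, Suc (length es)) := {})) (?i, j)"
        "\<And>i' j. i' \<noteq> ?i \<Longrightarrow> h2 (i', j) = (h1((?i, length es) := Some c)) (i', j) \<and>
           v2 (i', j) = (v1((?i, Suc (length es)) := {})) (i', j)"
      have h2: "h2 (i', j) = h (i', j)" if "i' \<noteq> ?i" for i' j
        using 1(4)[of i' j] 2(6)[of i' j] that by simp
      have "thin_sweep n x y ?B (grid_rows n (Suc ?i)) h2 v2 =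
        (if \<forall>i\<in>{1..?i}. h2 (i, 0) = Some (w i)
         then word_sum x y (map w [Suc ?i..<Suc n]) (Suc ?i) r else 0)"
      proof (rule Suc.hyps(1))
        show "v2 (?i, j) = {}" if "j \<in> {length r<..n}" for j
          using that 1(2)[of j] 2(3) 2(5)[of j] u(2) by (cases "j = Suc m") auto
        show "h2 (i, n) = None" if "i \<in> {?i<..n}" for i
          using that Suc.prems(5)[of i] h2 by simp
      qed (use 2 n u in auto)
      also have "(\<forall>i\<in>{1..?i}. h2 (i, 0) = Some (w i)) \<longleftrightarrow>
          d = w ?i \<and> (\<forall>i\<in>{1..p}. h (i, 0) = Some (w i))"
        using 2(1) h2 by (auto simp: atLeastAtMostSuc_conv)
      finally show "thin_sweep n x y ?B (grid_rows n (Suc ?i)) h2 v2 = ?K d r" by simp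
    qed (use Suc.prems(3) u in auto)
    finally show "thin_sweep n x y ?B
      ((?i, Suc m) # map (Pair ?i) (rev [1..<Suc m]) @ grid_rows n (Suc ?i)) h1 v1
      = row_sum (x ?i) y c es ?K" .
  qed (use n in auto)
  also have "row_sum (x ?i) y c es ?K =
    (if \<forall>i\<in>{1..p}. h (i, 0) = Some (w i)
     then word_sum x y (map w [?i..<Suc n]) ?i u else 0)"
  proof (cases "\<forall>i\<in>{1..p}. h (i, 0) = Some (w i)")
    case True
    then show ?thesis using n by (simp add: u upt_conv_Cons del: upt_Suc cong: if_cong)
  next
    case False
    then have "?K = (\<lambda>d r. 0)" by (auto simp: fun_eq_iff)
    with False show ?thesis by (simp only: row_sum_zero if_False)
  qed
  finally show ?case unfolding first_row .
qed

section \<open>The partition function at t = 0\<close>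

lemma poly_weight_0:
  "poly (weight [:0, 1:] [:z:] L S R S') 0 = weight 0 z L S R S'"
  by (cases L; cases R) simp_all

text \<open>
  The number of vertical colors can drop only where one of them turns into an uncolored row, and
  at \<open>t = 0\<close> that weight vanishes unless the color that turns is the only one.
\<close>

lemma weight_0_thin:
  assumes "weight 0 z L S R S' \<noteq> 0" "finite S" "card S' \<le> 1"
  shows "card S \<le> 1"
proof (cases L; cases R)
  assume "L = None" "R = None"
  then show ?thesis using assms by (simp split: if_splits)
next
  fix c assume "L = None" "R = Some c"
  with assms have "c \<in> S" "card {e \<in> S. e < c} = 0" "card {e \<in> S. c < e} = 0"
    by (auto simp: power_0_left split: if_splits)
  then have "S = {c}" using assms(2) by auto (metis linorder_neqE_nat)
  then show ?thesis by simp
next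
  fix c assume "L = Some c" "R = None"
  with assms have "S \<subseteq> S'" "S' = insert c S" by (auto split: if_splits)
  then show ?thesis using assms(2,3) card_mono[of S' S] by simp
next
  fix a b assume LR: "L = Some a" "R = Some b"
  show ?thesis
  proof (cases "a = b")
    case True
    then show ?thesis using assms LR by (simp split: if_splits)
  next
    case False
    with assms LR have "b \<in> S" "a \<notin> S" "S' = (S \<union> {a}) - {b}" by (auto split: if_splits)
    moreover from this have "0 < card S" using assms(2) by (auto simp: card_gt_0_iff)
    ultimately have "card S' = card S" using assms(2) False by (simp add: insert_Diff_if)
    then show ?thesis using assms(3) by simp
  qed
qed

lemma set_grid_rows: "set (grid_rows n i) = {i..n} \<times> {1..n}"
  by (auto simp: grid_rows_def image_iff simp del: upt_Suc)

lemma right_edge_grid: "right_edge ` ({1..n} \<times> {1..n}) = {1..n} \<times> {0..<n}"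
proof (intro set_eqI iffI)
  fix e assume "e \<in> {1..n} \<times> {0..<n}"
  then have "e = right_edge (fst e, Suc (snd e))" "(fst e, Suc (snd e)) \<in> {1..n} \<times> {1..n}"
    by (auto simp: right_edge_def)
  then show "e \<in> right_edge ` ({1..n} \<times> {1..n})" by (rule image_eqI)
qed (auto simp: right_edge_def)

lemma reading_order_if_sorted:
  assumes "sorted_wrt (\<lambda>p q. fst p < fst q \<or> fst p = fst q \<and> snd q < snd p) ps"
    and "\<forall>p\<in>set ps. 1 \<le> fst p \<and> 1 \<le> snd p"
  shows "reading_order ps"
  using assms by (induction ps) (force simp: right_edge_def top_edge_def)+

lemma sorted_wrt_grid_rows:
  "sorted_wrt (\<lambda>p q. fst p < fst q \<or> fst p = fst q \<and> snd q < snd p) (grid_rows n i)"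
proof (induction "Suc n - i" arbitrary: i)
  case 0
  then show ?case by (simp add: grid_rows_def del: upt_Suc)
next
  case (Suc d)
  then have "i \<le> n" by simp
  have "sorted_wrt (\<lambda>p q. fst p < fst q \<or> fst p = fst q \<and> snd q < snd p)
      (map (Pair i) (rev [1..<Suc n]))"
    by (simp add: sorted_wrt_map sorted_wrt_rev del: upt_Suc)
  then show ?case
    unfolding grid_rows_step[OF \<open>i \<le> n\<close>] sorted_wrt_append
    using Suc by (auto simp: set_grid_rows simp del: upt_Suc)
qed

lemma reading_order_grid_rows: "reading_order (grid_rows n 1)"
  by (rule reading_order_if_sorted[OF sorted_wrt_grid_rows]) (auto simp: set_grid_rows)

text \<open>
  The left and top boundary spins; \<^const>\<open>undefined\<close> is the value of extensional functions outside
  their domain.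
\<close>

definition initial_h :: "nat \<Rightarrow> hspins" where
  "initial_h n = (\<lambda>(i, j). if i \<in> {1..n} \<and> j = n then None else undefined)"

definition initial_v :: "nat \<Rightarrow> (nat \<Rightarrow> nat) \<Rightarrow> vspins" where
  "initial_v n \<sigma> = (\<lambda>(i, j). if i = 0 \<and> j \<in> {1..n} then {\<sigma> j} else undefined)"

lemma states_eq:
  assumes "\<sigma> ` {1..n} \<subseteq> {1..n}"
  shows "(h, v) \<in> states n \<sigma> w \<longleftrightarrow>
    (h, v) \<in> completions (spins n) (Pow {1..n}) (grid_rows n 1) (initial_h n) (initial_v n \<sigma>)
    \<and> boundary n w h v"
    (is "?L \<longleftrightarrow> ?R")
proof
  assume ?L
  then have h: "h \<in> {1..n} \<times> {0..n} \<rightarrow>\<^sub>E spins n" and v: "v \<in> {0..n} \<times> {1..n} \<rightarrow>\<^sub>E Pow {1..n}"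
    and v0: "\<And>j. j \<in> {1..n} \<Longrightarrow> v (0, j) = {\<sigma> j}"
    and hn: "\<And>i. i \<in> {1..n} \<Longrightarrow> h (i, n) = None" and b: "boundary n w h v"
    unfolding states_def spins_def boundary_def by auto
  have "if e \<in> {1..n} \<times> {0..<n} then h e \<in> spins n else h e = initial_h n e" for e
  proof (cases "e \<in> {1..n} \<times> {0..n}")
    case True
    obtain i j where ij: "e = (i, j)" by (cases e)
    show ?thesis
      using PiE_mem[OF h True] True hn[of i] by (cases "j = n") (auto simp: ij initial_h_def)
  next
    case False
    then show ?thesis using PiE_arb[OF h False] by (auto simp: initial_h_def split: prod.split)
  qed
  moreover have "if p \<in> {1..n} \<times> {1..n} then v p \<in> Pow {1..n} else v p = initial_v n \<sigma> p" for p
  proof (cases "p \<in> {0..n} \<times> {1..n}")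
    case True
    obtain i j where ij: "p = (i, j)" by (cases p)
    show ?thesis
      using PiE_mem[OF v True] True v0[of j] by (cases "i = 0") (auto simp: ij initial_v_def)
  next
    case False
    then show ?thesis using PiE_arb[OF v False] by (auto simp: initial_v_def split: prod.split)
  qed
  ultimately show ?R
    unfolding mem_completions_iff set_grid_rows right_edge_grid using b by blast
next
  assume ?R
  then have h: "\<And>e. if e \<in> {1..n} \<times> {0..<n} then h e \<in> spins n else h e = initial_h n e"
    and v: "\<And>p. if p \<in> {1..n} \<times> {1..n} then v p \<in> Pow {1..n} else v p = initial_v n \<sigma> p"
    and b: "boundary n w h v"
    unfolding mem_completions_iff set_grid_rows right_edge_grid by blast+
  have hn: "h (i, n) = None" if "i \<in> {1..n}" for i
    using h[of "(i, n)"] that by (simp add: initial_h_def)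
  have v0: "v (0, j) = {\<sigma> j}" if "j \<in> {1..n}" for j
    using v[of "(0, j)"] that by (simp add: initial_v_def)
  have "h \<in> {1..n} \<times> {0..n} \<rightarrow>\<^sub>E spins n"
  proof (rule PiE_I)
    fix e assume e: "e \<in> {1..n} \<times> {0..n}"
    obtain i j where ij: "e = (i, j)" by (cases e)
    show "h e \<in> spins n"
      using h[of e] e hn[of i] by (cases "j = n") (auto simp: ij spins_def)
  next
    fix e assume "e \<notin> {1..n} \<times> {0..n}"
    moreover obtain i j where "e = (i, j)" by (cases e)
    ultimately show "h e = undefined" using h[of e] by (auto simp: initial_h_def split: if_splits)
  qed
  moreover have "v \<in> {0..n} \<times> {1..n} \<rightarrow>\<^sub>E Pow {1..n}"
  proof (rule PiE_I)
    fix p assume p: "p \<in> {0..n} \<times> {1..n}"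
    obtain i j where ij: "p = (i, j)" by (cases p)
    then have "j \<in> {1..n}" using p by simp
    then have "\<sigma> j \<in> {1..n}" using assms by blast
    then show "v p \<in> Pow {1..n}"
      using v[of p] p v0[of j] by (cases "i = 0") (auto simp: ij split: if_splits)
  next
    fix p assume "p \<notin> {0..n} \<times> {1..n}"
    moreover obtain i j where "p = (i, j)" by (cases p)
    ultimately show "v p = undefined" using v[of p] by (auto simp: initial_v_def split: if_splits)
  qed
  ultimately show ?L
    using hn v0 b by (simp add: states_def spins_def boundary_def)
qed

text \<open>
  Induction from the empty bottom boundary upwards, by \<open>weight_0_thin\<close>.
\<close>

lemma vertical_spins_thin:
  assumes nz: "\<And>p. p \<in> {1..n} \<times> {1..n} \<Longrightarrow>
      local_weight (\<lambda>(i, j). weight 0 (x i * y j)) h v p \<noteq> 0"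
    and sub: "\<And>p. p \<in> {1..n} \<times> {1..n} \<Longrightarrow> v p \<subseteq> {1..n}"
    and bot: "\<And>j. j \<in> {1..n} \<Longrightarrow> v (n, j) = {}"
    and j: "j \<in> {1..n}"
  shows "1 \<le> i \<Longrightarrow> i \<le> n \<Longrightarrow> card (v (i, j)) \<le> 1"
proof (induction "n - i" arbitrary: i)
  case 0
  then show ?case using bot j by simp
next
  case (Suc d)
  then have "card (v (Suc i, j)) \<le> 1" by simp
  moreover have "weight 0 (x (Suc i) * y j) (h (Suc i, j)) (v (i, j)) (h (Suc i, j - 1)) (v (Suc i, j)) \<noteq> 0"
    using nz[of "(Suc i, j)"] Suc j by (simp add: local_weight_def top_edge_def right_edge_def)
  moreover have "finite (v (i, j))"
    using sub[of "(i, j)"] Suc.prems Suc.hyps(2) j by (auto intro: finite_subset)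
  ultimately show ?case by (metis weight_0_thin)
qed

text \<open>
  The sweep also visits configurations that violate the right or bottom boundary condition, and it
  omits the states with more than one color on a vertical edge; both kinds contribute zero.
\<close>

lemma partition_function_eq_sweep:
  assumes "\<sigma> ` {1..n} \<subseteq> {1..n}"
  shows "partition_function_t0 n \<sigma> w =
    thin_sweep n x_var y_inv (\<lambda>h v. of_bool (boundary n w h v))
      (grid_rows n 1) (initial_h n) (initial_v n \<sigma>)"
proof -
  let ?W = "\<lambda>(i, j). weight 0 (x_var i * y_inv j)"
  let ?f = "\<lambda>(h, v). \<Prod>p\<in>{1..n} \<times> {1..n}. local_weight ?W h v p"
  let ?C = "\<lambda>Q. completions (spins n) Q (grid_rows n 1) (initial_h n) (initial_v n \<sigma>)"
  let ?g = "\<lambda>(h, v). ?f (h, v) * of_bool (boundary n w h v)"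
  note states = states_eq[OF assms]
  have "partition_function_t0 n \<sigma> w = (\<Sum>s\<in>states n \<sigma> w. ?f s)"
    unfolding partition_function_t0_def partition_function_def
    by (simp add: poly_sum poly_prod poly_weight_0 case_prod_unfold
        local_weight_def top_edge_def right_edge_def prod.cartesian_product)
  also have "\<dots> = (\<Sum>s\<in>?C (Pow {1..n}). ?g s)"
    by (rule sum.mono_neutral_cong_left) (auto simp: states finite_completions finite_spins)
  also have "\<dots> = (\<Sum>s\<in>?C (thin_sets n). ?g s)"
  proof (rule sum.mono_neutral_right)
    show "finite (?C (Pow {1..n}))" by (simp add: finite_completions finite_spins)
    show "?C (thin_sets n) \<subseteq> ?C (Pow {1..n})"
      by (auto simp: mem_completions_iff thin_sets_def subset_iff)
    show "\<forall>s\<in>?C (Pow {1..n}) - ?C (thin_sets n). ?g s = 0"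
    proof
      fix s assume s: "s \<in> ?C (Pow {1..n}) - ?C (thin_sets n)"
      obtain h v where hv: "s = (h, v)" by (cases s)
      show "?g s = 0"
      proof (rule ccontr)
        assume "?g s \<noteq> 0"
        then have b: "boundary n w h v"
          and nz: "p \<in> {1..n} \<times> {1..n} \<Longrightarrow> local_weight ?W h v p \<noteq> 0" for p
          by (auto simp: hv)
        have c: "\<forall>e. if e \<in> right_edge ` set (grid_rows n 1) then h e \<in> spins n
              else h e = initial_h n e"
          "\<forall>p. if p \<in> set (grid_rows n 1) then v p \<in> Pow {1..n} else v p = initial_v n \<sigma> p"
          using s unfolding hv Diff_iff mem_completions_iff by blast+
        have sub: "v p \<subseteq> {1..n}" if "p \<in> {1..n} \<times> {1..n}" for p
          using c(2)[rule_format, of p] that unfolding set_grid_rows by simp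
        have "v p \<in> thin_sets n" if "p \<in> {1..n} \<times> {1..n}" for p
          using that sub[OF that] vertical_spins_thin[of n x_var y_inv h v "snd p" "fst p"] nz sub b
          by (auto simp: thin_sets_def boundary_def)
        then have "\<forall>p. if p \<in> set (grid_rows n 1) then v p \<in> thin_sets n
            else v p = initial_v n \<sigma> p"
          using c(2) unfolding set_grid_rows by presburger
        with c(1) have "s \<in> ?C (thin_sets n)" unfolding hv mem_completions_iff by blast
        then show False using s by blast
      qed
    qed
  qed
  also have "\<dots> = thin_sweep n x_var y_inv (\<lambda>h v. of_bool (boundary n w h v))
      (grid_rows n 1) (initial_h n) (initial_v n \<sigma>)"
    by (subst sweep_eq_sum[OF finite_spins finite_thin_sets reading_order_grid_rows])
      (simp add: set_grid_rows)
  finally show ?thesis .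
qed

lemma col_word_rev_upt:
  "(\<And>j. j \<in> {1..m} \<Longrightarrow> f j = {j}) \<Longrightarrow> col_word f (rev [1..<Suc m])"
  by (induction m) auto

lemma partition_function_eq_lattice_sum:
  "partition_function_t0 n id w = lattice_sum n w"
proof -
  have "thin_sweep n x_var y_inv (\<lambda>h v. of_bool (boundary n w h v))
      (grid_rows n (Suc 0)) (initial_h n) (initial_v n id)
    = (if \<forall>i\<in>{1..0}. initial_h n (i, 0) = Some (w i)
       then word_sum x_var y_inv (map w [Suc 0..<Suc n]) (Suc 0) (rev [1..<Suc n]) else 0)"
  proof (rule sweep_rows)
    show "col_word (\<lambda>j. initial_v n id (0, j)) (rev [1..<Suc n])"
      by (rule col_word_rev_upt) (simp add: initial_v_def)
  qed (auto simp: initial_h_def simp del: upt_Suc)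
  then show ?thesis
    by (simp add: partition_function_eq_sweep lattice_sum_def del: upt_Suc)
qed

theorem corollary8p9:
  fixes n :: nat and w :: "nat \<Rightarrow> nat"
  assumes "w permutes {1..n}"
  shows "partition_function_t0 n id w = (- 1) ^ len n (inv w \<circ> longest n) * grothendieck n w"
  unfolding partition_function_eq_lattice_sum
  by (rule lattice_sum_eq_grothendieck[OF assms])

end
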